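(* Let $P$ be a special product rule. There is an algorithm which, given a finite alphabet $\Sigma$, a $P$-automaton $\mathcal A=\langle X,F,\Delta\rangle$ with finite $X$ and rational data, and $x_1\in X$, decides whether the series $[\![x_1]\!]_{\mathcal A}$ is commutative.
   Context: Let $\Sigma$ be a finite alphabet, $\Sigma^*$ the finite words with empty word $\varepsilon$. A series is $f:\Sigma^*\to\mathbb Q$, $f_w=f(w)$; $\delta_af$ ($a\in\Sigma$) is $w\mapsto f(aw)$. A series $f$ is commutative if $f_u=f_v$ for all words $u,v$ having the same commutative image (i.e. each letter occurs the same number of times in $u$ and in $v$). Terms over $X$: generated by $u,v::=x\mid 0\mid c\cdot u\mid u+v\mid u*v$ ($c\in\mathbb Q$). A product rule is a term $P$ over $\{x,\dot x,y,\dot y\}$; $P(s_1,\dots,s_4)$ is substitution. $u\approx v$ iff $u,v$ denote the same commutative polynomial over $\mathbb Q$. $P$ is special if $P(x+y,\dot x+\dot y,z,\dot z)\approx P(x,\dot x,z,\dot z)+P(y,\dot y,z,\dot z)$, $P(x,\dot x,y*z,P(y,\dot y,z,\dot z))\approx P(x*y,P(x,\dot x,y,\dot y),z,\dot z)$, $P(x,\dot x,y,\dot y)\approx P(y,\dot y,x,\dot x)$. $P$-automaton: $\mathcal A=\langle X,F,\Delta\rangle$ with $F:X\to\mathbb Q$ and $\Delta_a:X\to\mathrm{Terms}(X)$ ($a\in\Sigma$). The $P$-extension $\tilde D$ of $D:X\to\mathrm{Terms}(X)$: $\tilde D0=0$, $\tilde Dx=Dx$, $\tilde D(c\alpha)=c\tilde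 D\alpha$, $\tilde D(\alpha+\beta)=\tilde D\alpha+\tilde D\beta$, $\tilde D(\alpha*\beta)=P(\alpha,\tilde D\alpha,\beta,\tilde D\beta)$. $F$ extends to terms by evaluation in $\mathbb Q$. $[\![\alpha]\!]_{\mathcal A}$ is the unique series with constant term $F(\alpha)$ and $\delta_a[\![\alpha]\!]_{\mathcal A}=[\![\tilde\Delta_a\alpha]\!]_{\mathcal A}$. *)

theory Defs
  imports Complex_Main "HOL-Library.Poly_Mapping" "HOL-Library.Nat_Bijection"
begin

datatype trm = Var nat | Zero | Scal rat trm | Plus trm trm | Times trm trm

fun vars :: "trm \<Rightarrow> nat set" where
  "vars (Var x) = {x}"
| "vars Zero = {}"
| "vars (Scal c t) = vars t"
| "vars (Plus s t) = vars s \<union> vars t"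
| "vars (Times s t) = vars s \<union> vars t"

fun subst :: "(nat \<Rightarrow> trm) \<Rightarrow> trm \<Rightarrow> trm" where
  "subst \<sigma> (Var x) = \<sigma> x"
| "subst \<sigma> Zero = Zero"
| "subst \<sigma> (Scal c t) = Scal c (subst \<sigma> t)"
| "subst \<sigma> (Plus s t) = Plus (subst \<sigma> s) (subst \<sigma> t)"
| "subst \<sigma> (Times s t) = Times (subst \<sigma> s) (subst \<sigma> t)"

type_synonym mpoly = "(nat \<Rightarrow>\<^sub>0 nat) \<Rightarrow>\<^sub>0 rat"

fun denot :: "trm \<Rightarrow> mpoly" where
  "denot (Var x) = Poly_Mapping.single (Poly_Mapping.single x 1) 1"
| "denot Zero = 0"
| "denot (Scal c t) = Poly_Mapping.single 0 c * denot t"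
| "denot (Plus s t) = denot s + denot t"
| "denot (Times s t) = denot s * denot t"

definition peq :: "trm \<Rightarrow> trm \<Rightarrow> bool" (infix "\<approx>" 50) where
  "s \<approx> t \<longleftrightarrow> denot s = denot t"

text \<open>A product rule is a term over the four variables x, x', y, y', which are
  represented by the variables 0, 1, 2, 3.  P(s1,s2,s3,s4) is substitution.\<close>

definition product_rule :: "trm \<Rightarrow> bool" where
  "product_rule P \<longleftrightarrow> vars P \<subseteq> {0, 1, 2, 3}"

definition app4 :: "trm \<Rightarrow> trm \<Rightarrow> trm \<Rightarrow> trm \<Rightarrow> trm \<Rightarrow> trm" where
  "app4 P s1 s2 s3 s4 =
     subst (\<lambda>i. if i = 0 then s1 else if i = 1 then s2 else if i = 2 then s3
                else if i = 3 then s4 else Var i) P"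

definition special :: "trm \<Rightarrow> bool" where
  "special P \<longleftrightarrow>
     (let x = Var 0; x' = Var 1; y = Var 2; y' = Var 3; z = Var 4; z' = Var 5 in
       app4 P (Plus x y) (Plus x' y') z z' \<approx> Plus (app4 P x x' z z') (app4 P y y' z z')
     \<and> app4 P x x' (Times y z) (app4 P y y' z z') \<approx> app4 P (Times x y) (app4 P x x' y y') z z'
     \<and> app4 P x x' y y' \<approx> app4 P y y' x x')"

fun pext :: "trm \<Rightarrow> (nat \<Rightarrow> trm) \<Rightarrow> trm \<Rightarrow> trm" where
  "pext P D Zero = Zero"
| "pext P D (Var x) = D x"
| "pext P D (Scal c t) = Scal c (pext P D t)"
| "pext P D (Plus s t) = Plus (pext P D s) (pext P D t)"
| "pext P D (Times s t) = app4 P s (pext P D s) t (pext P D t)"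

fun evalF :: "(nat \<Rightarrow> rat) \<Rightarrow> trm \<Rightarrow> rat" where
  "evalF F (Var x) = F x"
| "evalF F Zero = 0"
| "evalF F (Scal c t) = c * evalF F t"
| "evalF F (Plus s t) = evalF F s + evalF F t"
| "evalF F (Times s t) = evalF F s * evalF F t"

text \<open>The series [[alpha]] of a P-automaton with output F and transitions
  Delta (letter a gives Delta a : X -> Terms(X)); words are lists of letters.
  This is the unique series with constant term F(alpha) and
  delta_a [[alpha]] = [[Delta~_a alpha]].\<close>

fun sem :: "trm \<Rightarrow> (nat \<Rightarrow> rat) \<Rightarrow> (nat \<Rightarrow> nat \<Rightarrow> trm) \<Rightarrow> trm \<Rightarrow> nat list \<Rightarrow> rat" where
  "sem P F \<Delta> \<alpha> [] = evalF F \<alpha>"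
| "sem P F \<Delta> \<alpha> (a # w) = sem P F \<Delta> (pext P (\<Delta> a) \<alpha>) w"

definition commutative_series :: "nat \<Rightarrow> (nat list \<Rightarrow> rat) \<Rightarrow> bool" where
  "commutative_series k f \<longleftrightarrow>
     (\<forall>u v. set u \<subseteq> {..<k} \<longrightarrow> set v \<subseteq> {..<k} \<longrightarrow> (\<forall>a. count_list u a = count_list v a) \<longrightarrow> f u = f v)"

datatype recf = Zf | Sf | Idf nat | Cnf recf "recf list" | Prf recf recf | Mnf recf

inductive rec_eval :: "recf \<Rightarrow> nat list \<Rightarrow> nat \<Rightarrow> bool" where
  zero: "rec_eval Zf xs 0"
| succ: "rec_eval Sf (x # xs) (Suc x)"
| proj: "i < length xs \<Longrightarrow> rec_eval (Idf i) xs (xs ! i)"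
| comp: "list_all2 (\<lambda>g y. rec_eval g xs y) gs ys \<Longrightarrow> rec_eval f ys r \<Longrightarrow> rec_eval (Cnf f gs) xs r"
| pr0: "rec_eval f xs r \<Longrightarrow> rec_eval (Prf f g) (0 # xs) r"
| prS: "rec_eval (Prf f g) (n # xs) r \<Longrightarrow> rec_eval g (n # r # xs) r'
         \<Longrightarrow> rec_eval (Prf f g) (Suc n # xs) r'"
| mn: "rec_eval f (n # xs) 0 \<Longrightarrow> (\<forall>m<n. \<exists>y. rec_eval f (m # xs) y \<and> 0 < y)
         \<Longrightarrow> rec_eval (Mnf f) xs n"

definition enc_rat :: "rat \<Rightarrow> nat" where
  "enc_rat q = (case quotient_of q of (a, b) \<Rightarrow> prod_encode (int_encode a, int_encode b))"

fun enc_trm :: "trm \<Rightarrow> nat" where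
  "enc_trm (Var x) = list_encode [0, x]"
| "enc_trm Zero = list_encode [1]"
| "enc_trm (Scal c t) = list_encode [2, enc_rat c, enc_trm t]"
| "enc_trm (Plus s t) = list_encode [3, enc_trm s, enc_trm t]"
| "enc_trm (Times s t) = list_encode [4, enc_trm s, enc_trm t]"

text \<open>Input: alphabet {0..<k}, states X = {0..<n}, F given by the list Fs
  (F i = Fs ! i), Delta given by Ds (Delta_a i = Ds ! a ! i), start state x1.\<close>

definition enc_input :: "nat \<Rightarrow> nat \<Rightarrow> rat list \<Rightarrow> trm list list \<Rightarrow> nat \<Rightarrow> nat" where
  "enc_input k n Fs Ds x1 =
     list_encode [k, n, list_encode (map enc_rat Fs),
                  list_encode (map (\<lambda>row. list_encode (map enc_trm row)) Ds), x1]"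

definition valid_input :: "nat \<Rightarrow> nat \<Rightarrow> rat list \<Rightarrow> trm list list \<Rightarrow> nat \<Rightarrow> bool" where
  "valid_input k n Fs Ds x1 \<longleftrightarrow>
     length Fs = n \<and> length Ds = k \<and>
     (\<forall>row\<in>set Ds. length row = n \<and> (\<forall>t\<in>set row. vars t \<subseteq> {..<n})) \<and> x1 < n"

end

theory Submission
  imports Defs "HOL-Library.Function_Algebras" "HOL-Computational_Algebra.Polynomial"
begin

text \<open>
  A special product rule is a symmetric bilinear form \<open>\<alpha>xy + \<beta>(xy' + x'y) + \<gamma>x'y'\<close> with
  \<open>\<beta>\<^sup>2 = \<alpha>\<gamma> + \<beta>\<close>, so the \<open>P\<close>-extensions \<open>\<Delta>\<^sub>a\<close> act on polynomials, and an ideal whose generators are mapped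
  into it by all \<open>\<Delta>\<^sub>a\<close> is stable.  Hence, by Hilbert's basis theorem, \<open>\<lbrakk>t\<rbrakk> = 0\<close> holds
  iff \<open>t\<close> lies in a finitely generated stable ideal on which \<open>F\<close> vanishes, and such an ideal is a
  finite certificate.

  Since permutations are generated by rotations and by the exchange of the first two letters, a series
  \<open>f\<close> is commutative iff \<open>f(abw) = f(baw)\<close> and \<open>f(aw) = f(wa)\<close> for all \<open>a\<close>, \<open>b\<close>, \<open>w\<close>.
  The right derivative \<open>w \<mapsto> f(wa)\<close> obeys the same product rule, and it is recognised by an automaton
  with a second copy of the variables; so commutativity is a finite conjunction of zeroness problems.
  Both commutativity and its negation therefore have finite, checkable witnesses, and an unbounded search
  decides between them.
\<close>

section \<open>Recursive functions\<close>

text \<open>Each summand of the bilinear form P(q, q', g, g') contains g or g', so the ideal absorbs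
  the P-extension of a multiple of g as soon as it contains g and g'. The relation between
  \<open>\<alpha>\<close>, \<open>\<beta>\<close> and \<open>\<gamma>\<close> is the associativity
  axiom read off at one point. It is what makes \<open>pext\<close>, a recursion over syntax,
  respect equality of polynomials.

  Exchanging neighbours at every position would give one zeroness problem per prefix, hence
  infinitely many. Rotations remove the prefix; their price is the right derivative, and with it the
  doubled automaton.

  The basis theorem gives no bound on the generators, so an unbounded search has to find them.
  Membership in an ideal is certified in turn by explicit cofactors, and what is left to check is a
  polynomial identity, tested on a finite grid. The rule P is fixed in advance, so the program may
  depend on it.\<close>

definition recn :: "nat \<Rightarrow> (nat list \<Rightarrow> nat) \<Rightarrow> bool" where
  "recn n f \<longleftrightarrow> (\<exists>r. \<forall>xs. length xs = n \<longrightarrow> rec_eval r xs (f xs))"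

lemma recn_const: "recn n (\<lambda>_. c)"
proof (induction c)
  case 0
  show ?case unfolding recn_def by (rule exI[of _ Zf]) (simp add: rec_eval.zero)
next
  case (Suc c)
  then obtain r where r: "\<And>xs. length xs = n \<Longrightarrow> rec_eval r xs c"
    unfolding recn_def by blast
  have "rec_eval (Cnf Sf [r]) xs (Suc c)" if "length xs = n" for xs
    using r[OF that] by (intro rec_eval.comp[where ys = "[c]"] rec_eval.succ) simp
  then show ?case unfolding recn_def by blast
qed

lemma recn_nth: "i < n \<Longrightarrow> recn n (\<lambda>xs. xs ! i)"
  unfolding recn_def by (rule exI[of _ "Idf i"]) (simp add: rec_eval.proj)

lemma recn_comp1:
  assumes "recn 1 (\<lambda>ys. h (ys ! 0))" "recn n f"
  shows "recn n (\<lambda>xs. h (f xs))"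
proof -
  obtain r s where r: "\<And>xs. length xs = 1 \<Longrightarrow> rec_eval r xs (h (xs ! 0))"
    and s: "\<And>xs. length xs = n \<Longrightarrow> rec_eval s xs (f xs)"
    using assms unfolding recn_def by blast
  have "rec_eval (Cnf r [s]) xs (h (f xs))" if "length xs = n" for xs
    using s[OF that] r[of "[f xs]"] by (intro rec_eval.comp[where ys = "[f xs]"]) simp_all
  then show ?thesis unfolding recn_def by blast
qed

lemma recn_comp2:
  assumes "recn 2 (\<lambda>ys. h (ys ! 0) (ys ! 1))" "recn n f" "recn n g"
  shows "recn n (\<lambda>xs. h (f xs) (g xs))"
proof -
  obtain r s t where r: "\<And>xs. length xs = 2 \<Longrightarrow> rec_eval r xs (h (xs ! 0) (xs ! 1))"
    and s: "\<And>xs. length xs = n \<Longrightarrow> rec_eval s xs (f xs)"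
    and t: "\<And>xs. length xs = n \<Longrightarrow> rec_eval t xs (g xs)"
    using assms unfolding recn_def by blast
  have "rec_eval (Cnf r [s, t]) xs (h (f xs) (g xs))" if "length xs = n" for xs
    using s[OF that] t[OF that] r[of "[f xs, g xs]"]
    by (intro rec_eval.comp[where ys = "[f xs, g xs]"]) simp_all
  then show ?thesis unfolding recn_def by blast
qed

lemma recn_Suc: "recn n f \<Longrightarrow> recn n (\<lambda>xs. Suc (f xs))"
proof (rule recn_comp1[where h = "Suc"])
  have "rec_eval Sf xs (Suc (xs ! 0))" if "length xs = 1" for xs
    using that by (cases xs) (auto intro: rec_eval.succ)
  then show "recn 1 (\<lambda>ys. Suc (ys ! 0))" unfolding recn_def by blast
qed

lemma recn_rec_1:
  assumes "recn 2 (\<lambda>ys. g (ys ! 0) (ys ! 1))"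
  shows "recn 1 (\<lambda>ys. rec_nat a g (ys ! 0))"
proof -
  obtain r where r: "\<And>xs. length xs = 0 \<Longrightarrow> rec_eval r xs a"
    using recn_const[of 0 a] unfolding recn_def by blast
  obtain s where s: "\<And>xs. length xs = 2 \<Longrightarrow> rec_eval s xs (g (xs ! 0) (xs ! 1))"
    using assms unfolding recn_def by blast
  have "rec_eval (Prf r s) [m] (rec_nat a g m)" for m
  proof (induction m)
    case 0
    show ?case using r[of "[]"] by (simp add: rec_eval.pr0)
  next
    case (Suc m)
    show ?case using rec_eval.prS[OF Suc s[of "[m, rec_nat a g m]"]] by simp
  qed
  then have "rec_eval (Prf r s) xs (rec_nat a g (xs ! 0))" if "length xs = 1" for xs
    using that by (cases xs) auto
  then show ?thesis unfolding recn_def by blast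
qed

text \<open>One parameter is enough, since several can be packed into one number. The step function
  of \<open>Prf\<close> receives counter, accumulator and parameter in this order, whence the
  indices 0, 1, 2.\<close>

lemma recn_rec_2:
  assumes "recn 1 (\<lambda>ys. a (ys ! 0))" "recn 3 (\<lambda>ys. g (ys ! 2) (ys ! 0) (ys ! 1))"
  shows "recn 2 (\<lambda>ys. rec_nat (a (ys ! 1)) (g (ys ! 1)) (ys ! 0))"
proof -
  obtain r where r: "\<And>xs. length xs = 1 \<Longrightarrow> rec_eval r xs (a (xs ! 0))"
    using assms unfolding recn_def by blast
  obtain s where s: "\<And>xs. length xs = 3 \<Longrightarrow> rec_eval s xs (g (xs ! 2) (xs ! 0) (xs ! 1))"
    using assms unfolding recn_def by blast
  have "rec_eval (Prf r s) [m, x] (rec_nat (a x) (g x) m)" for m x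
  proof (induction m)
    case 0
    show ?case using r[of "[x]"] by (simp add: rec_eval.pr0)
  next
    case (Suc m)
    show ?case using rec_eval.prS[OF Suc s[of "[m, rec_nat (a x) (g x) m, x]"]] by simp
  qed
  then have "rec_eval (Prf r s) xs (rec_nat (a (xs ! 1)) (g (xs ! 1)) (xs ! 0))" if "length xs = 2" for xs
    using that by (cases xs; cases "tl xs") auto
  then show ?thesis unfolding recn_def by blast
qed

lemma recn_pred: "recn n f \<Longrightarrow> recn n (\<lambda>xs. f xs - 1)"
proof (rule recn_comp1[where h = "\<lambda>x. x - 1"])
  have "recn 1 (\<lambda>ys. rec_nat 0 (\<lambda>i r. i) (ys ! 0))"
    by (rule recn_rec_1) (simp add: recn_nth)
  moreover have "rec_nat 0 (\<lambda>i r. i) m = m - 1" for m :: nat by (cases m) auto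
  ultimately show "recn 1 (\<lambda>ys. ys ! 0 - 1)" by simp
qed

lemma recn_add: "recn n f \<Longrightarrow> recn n g \<Longrightarrow> recn n (\<lambda>xs. f xs + g xs)"
proof (rule recn_comp2[where h = "(+)"])
  have "recn 2 (\<lambda>ys. rec_nat (ys ! 1) (\<lambda>i r. Suc r) (ys ! 0))"
    by (rule recn_rec_2) (simp_all add: recn_nth recn_Suc)
  moreover have "rec_nat y (\<lambda>i r. Suc r) m = m + y" for m y :: nat by (induction m) auto
  ultimately show "recn 2 (\<lambda>ys. ys ! 0 + ys ! 1)" by simp
qed

lemma recn_diff: "recn n f \<Longrightarrow> recn n g \<Longrightarrow> recn n (\<lambda>xs. f xs - g xs)"
proof (rule recn_comp2[where h = "(-)"])
  \<comment> \<open>The recursion runs over the subtrahend, which \<open>Prf\<close> expects as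
    first argument; the arguments are exchanged back afterwards.\<close>
  have "recn 2 (\<lambda>ys. rec_nat (ys ! 1) (\<lambda>i r. r - 1) (ys ! 0))"
    by (rule recn_rec_2) (intro recn_pred recn_nth; simp)+
  moreover have "rec_nat y (\<lambda>i r. r - 1) m = y - m" for m y :: nat by (induction m) auto
  ultimately have *: "recn 2 (\<lambda>ys. ys ! 1 - ys ! 0)" by simp
  show "recn 2 (\<lambda>ys. ys ! 0 - ys ! 1)"
    using recn_comp2[where h = "\<lambda>x y. y - x", OF *, of 2 "\<lambda>ys. ys ! 1" "\<lambda>ys. ys ! 0"]
    by (simp add: recn_nth)
qed

lemma recn_mult: "recn n f \<Longrightarrow> recn n g \<Longrightarrow> recn n (\<lambda>xs. f xs * g xs)"
proof (rule recn_comp2[where h = "(*)"])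
  have "recn 2 (\<lambda>ys. rec_nat 0 (\<lambda>i r. r + ys ! 1) (ys ! 0))"
    by (rule recn_rec_2[where a = "\<lambda>_. 0" and g = "\<lambda>y i r. r + y"]) (simp_all add: recn_nth recn_const recn_add)
  moreover have "rec_nat 0 (\<lambda>i r. r + y) m = m * y" for m y :: nat by (induction m) auto
  ultimately show "recn 2 (\<lambda>ys. ys ! 0 * ys ! 1)" by simp
qed

lemma recn_triangle: "recn n f \<Longrightarrow> recn n (\<lambda>xs. triangle (f xs))"
proof (rule recn_comp1[where h = "triangle"])
  have "recn 1 (\<lambda>ys. rec_nat 0 (\<lambda>i r. r + Suc i) (ys ! 0))"
    by (rule recn_rec_1) (simp add: recn_nth recn_add recn_Suc)
  moreover have "rec_nat 0 (\<lambda>i r. r + Suc i) m = triangle m" for m by (induction m) auto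
  ultimately show "recn 1 (\<lambda>ys. triangle (ys ! 0))" by simp
qed

lemma recn_prod_encode: "recn n f \<Longrightarrow> recn n g \<Longrightarrow> recn n (\<lambda>xs. prod_encode (f xs, g xs))"
  unfolding prod_encode_def by (simp add: recn_add recn_triangle)

text \<open>Iterates \<open>s\<close> upwards while the next triangular number does not exceed \<open>c\<close>.\<close>

definition tri_root :: "nat \<Rightarrow> nat" where
  "tri_root c = rec_nat 0 (\<lambda>i s. s + (1 - (triangle (Suc s) - c))) c"

text \<open>The code \<open>triangle (m + n) + m\<close> lies below
  \<open>triangle (m + n + 1)\<close>, so the climb stops at \<open>m + n\<close>. Since
  \<open>m + n\<close> is at most the code, as many steps as the code says suffice.\<close>

lemma tri_root_prod_encode: "tri_root (prod_encode (m, n)) = m + n"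
proof -
  define c where "c = prod_encode (m, n)"
  have tri: "triangle (m + n) \<le> c" "c < triangle (Suc (m + n))"
    by (simp_all add: c_def prod_encode_def)
  have mono: "triangle i \<le> triangle j" if "i \<le> j" for i j
    using that by (induction rule: dec_induct) auto
  have ge: "i \<le> triangle i" for i by (cases i) simp_all
  have "rec_nat 0 (\<lambda>i s. s + (1 - (triangle (Suc s) - c))) j = min j (m + n)" for j
  proof (induction j)
    case 0
    show ?case by simp
  next
    case (Suc j)
    show ?case
    proof (cases "j < m + n")
      case True
      then have "triangle (Suc j) \<le> c" using mono[of "Suc j" "m + n"] tri by linarith
      then show ?thesis using Suc True by simp
    next
      case False
      then show ?thesis using Suc tri by (simp add: min_def)
    qed
  qed
  moreover have "m + n \<le> c" using ge[of "m + n"] tri by linarith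
  ultimately show ?thesis by (simp add: tri_root_def c_def[symmetric] min_absorb2)
qed

lemma fst_prod_decode: "fst (prod_decode c) = c - triangle (tri_root c)"
  and snd_prod_decode: "snd (prod_decode c) = tri_root c - fst (prod_decode c)"
proof -
  obtain m n where c: "c = prod_encode (m, n)" by (metis prod_decode_inverse surj_pair)
  show "fst (prod_decode c) = c - triangle (tri_root c)"
    unfolding c tri_root_prod_encode prod_encode_inverse by (simp add: prod_encode_def)
  show "snd (prod_decode c) = tri_root c - fst (prod_decode c)"
    unfolding c tri_root_prod_encode by simp
qed

lemma recn_tri_root: "recn n f \<Longrightarrow> recn n (\<lambda>xs. tri_root (f xs))"
proof (rule recn_comp1[where h = "tri_root"])
  have "recn 2 (\<lambda>ys. rec_nat 0 (\<lambda>i s. s + (1 - (triangle (Suc s) - ys ! 1))) (ys ! 0))"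
    by (rule recn_rec_2[where a = "\<lambda>_. 0" and g = "\<lambda>c i s. s + (1 - (triangle (Suc s) - c))"])
      (intro recn_add recn_diff recn_triangle recn_Suc recn_const recn_nth; simp)+
  from recn_comp2[where h = "\<lambda>m c. rec_nat 0 (\<lambda>i s. s + (1 - (triangle (Suc s) - c))) m", OF this,
      of 1 "\<lambda>ys. ys ! 0" "\<lambda>ys. ys ! 0"]
  show "recn 1 (\<lambda>ys. tri_root (ys ! 0))" by (simp add: tri_root_def recn_nth)
qed

lemma recn_fst: "recn n f \<Longrightarrow> recn n (\<lambda>xs. fst (prod_decode (f xs)))"
  unfolding fst_prod_decode by (intro recn_diff recn_triangle recn_tri_root)

lemma recn_snd: "recn n f \<Longrightarrow> recn n (\<lambda>xs. snd (prod_decode (f xs)))"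
  unfolding snd_prod_decode by (intro recn_diff recn_fst recn_tri_root)

definition recursive :: "(nat \<Rightarrow> nat) \<Rightarrow> bool" where
  "recursive f \<longleftrightarrow> recn 1 (\<lambda>xs. f (xs ! 0))"

lemma recn_recursive: "recursive f \<Longrightarrow> recn n g \<Longrightarrow> recn n (\<lambda>xs. f (g xs))"
  unfolding recursive_def by (rule recn_comp1)

lemma recursive_id: "recursive (\<lambda>c. c)"
  by (simp add: recursive_def recn_nth)

lemma recursive_const: "recursive (\<lambda>_. a)"
  by (simp add: recursive_def recn_const)

lemma recursive_compose: "recursive f \<Longrightarrow> recursive g \<Longrightarrow> recursive (\<lambda>c. f (g c))"
  unfolding recursive_def by (rule recn_comp1)

lemma recursive_unary:
  assumes "recursive f"
  shows "recursive (\<lambda>c. Suc (f c))" "recursive (\<lambda>c. fst (prod_decode (f c)))"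
    "recursive (\<lambda>c. snd (prod_decode (f c)))"
  using assms unfolding recursive_def by (simp_all add: recn_Suc recn_fst recn_snd)

lemma recursive_arith:
  assumes "recursive f" "recursive g"
  shows "recursive (\<lambda>c. f c + g c)" "recursive (\<lambda>c. f c - g c)"
    "recursive (\<lambda>c. f c * g c)" "recursive (\<lambda>c. prod_encode (f c, g c))"
  using assms unfolding recursive_def
  by (simp_all add: recn_add recn_diff recn_mult recn_prod_encode)

lemma recursive_rec_nat:
  assumes "recursive a" "recursive (\<lambda>p. g (fst (prod_decode p)) (fst (prod_decode (snd (prod_decode p))))
    (snd (prod_decode (snd (prod_decode p)))))" "recursive m"
  shows "recursive (\<lambda>c. rec_nat (a c) (g c) (m c))"
proof -
  have "recn 3 (\<lambda>ys. g (ys ! 2) (ys ! 0) (ys ! 1))"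
    using recn_recursive[OF assms(2),
        of 3 "\<lambda>ys. prod_encode (ys ! 2, prod_encode (ys ! 0, ys ! 1))"]
    by (simp add: recn_prod_encode recn_nth)
  with assms(1) have "recn 2 (\<lambda>ys. rec_nat (a (ys ! 1)) (g (ys ! 1)) (ys ! 0))"
    by (intro recn_rec_2) (simp_all add: recursive_def)
  from recn_comp2[where h = "\<lambda>m c. rec_nat (a c) (g c) m", OF this, of 1 "\<lambda>ys. m (ys ! 0)" "\<lambda>ys. ys ! 0"]
  show ?thesis using assms(3) by (simp add: recursive_def recn_nth)
qed

section \<open>Computable functions on numbered types\<close>

text \<open>The numbering \<open>dec\<close> need not be injective, so rational numbers need not be kept in lowest terms.\<close>

class numbered =
  fixes dec :: "nat \<Rightarrow> 'a"
  assumes surj_dec: "surj dec"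

instantiation nat :: numbered
begin
definition dec_nat :: "nat \<Rightarrow> nat" where "dec_nat c = c"
instance by standard (auto simp: dec_nat_def surj_def)
end

instantiation bool :: numbered
begin
definition dec_bool :: "nat \<Rightarrow> bool" where "dec_bool c \<longleftrightarrow> c \<noteq> 0"
instance by standard (auto simp: dec_bool_def surj_def)
end

instantiation prod :: (numbered, numbered) numbered
begin
definition dec_prod :: "nat \<Rightarrow> 'a \<times> 'b" where
  "dec_prod c = (dec (fst (prod_decode c)), dec (snd (prod_decode c)))"
instance
proof
  have "\<exists>c. (x :: 'a \<times> 'b) = dec c" for x
  proof -
    obtain a b where "fst x = dec a" "snd x = dec b" using surj_dec by (meson surjD)
    then have "x = dec (prod_encode (a, b))" by (simp add: dec_prod_def prod_eq_iff)
    then show ?thesis by blast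
  qed
  then show "surj (dec :: nat \<Rightarrow> 'a \<times> 'b)" by (auto simp: surj_def)
qed
end

instantiation list :: (numbered) numbered
begin
definition dec_list :: "nat \<Rightarrow> 'a list" where "dec_list c = map dec (list_decode c)"
instance
proof
  have "\<exists>c. (xs :: 'a list) = dec c" for xs
  proof -
    have "\<exists>cs. xs = map dec cs"
    proof (induction xs)
      case Nil
      show ?case by simp
    next
      case (Cons x xs)
      obtain a where "x = dec a" using surj_dec by (meson surjD)
      with Cons show ?case by (metis list.simps(9))
    qed
    then obtain cs where "xs = map dec cs" ..
    then have "xs = dec (list_encode cs)" by (simp add: dec_list_def)
    then show ?thesis ..
  qed
  then show "surj (dec :: nat \<Rightarrow> 'a list)" by (auto simp: surj_def)
qed
end

instantiation int :: numbered
begin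
definition dec_int :: "nat \<Rightarrow> int" where "dec_int = int_decode"
instance by standard (simp add: dec_int_def surj_int_decode)
end

definition quot :: "int \<times> int \<Rightarrow> rat" where
  "quot p = of_int (fst p) / of_int (snd p)"

instantiation rat :: numbered
begin
definition dec_rat :: "nat \<Rightarrow> rat" where "dec_rat c = quot (dec c)"
instance
proof
  have "\<exists>c. q = dec c" for q :: rat
  proof -
    obtain a b where "q = quot (a, b)"
      unfolding quot_def by (metis Rat_cases Fract_of_int_quotient fst_conv snd_conv)
    moreover obtain c where "(a, b) = dec c" using surj_dec by (meson surjD)
    ultimately show ?thesis by (metis dec_rat_def)
  qed
  then show "surj (dec :: nat \<Rightarrow> rat)" by (auto simp: surj_def)
qed
end

lemma dec_enc_rat: "dec (enc_rat q) = q"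
proof -
  obtain a b where ab: "quotient_of q = (a, b)" by fastforce
  then show ?thesis
    by (simp add: enc_rat_def dec_rat_def dec_prod_def dec_int_def quot_def quotient_of_div[OF ab])
qed

definition code_hd :: "nat \<Rightarrow> nat" where "code_hd c = fst (prod_decode (c - 1))"
definition code_tl :: "nat \<Rightarrow> nat" where "code_tl c = snd (prod_decode (c - 1))"

text \<open>The comparisons with \<open>c\<close> only serve termination: they hold for all codes of terms.\<close>

function dec_term :: "nat \<Rightarrow> trm" where
  "dec_term c = (let t = code_hd c; a = code_hd (code_tl c); b = code_hd (code_tl (code_tl c)) in
     if t = 0 then Var a
     else if t = 2 \<and> b < c then Scal (dec a) (dec_term b)
     else if t = 3 \<and> a < c \<and> b < c then Plus (dec_term a) (dec_term b)
     else if t = 4 \<and> a < c \<and> b < c then Times (dec_term a) (dec_term b)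
     else Zero)"
  by auto
termination by (relation "measure id") auto

declare dec_term.simps [simp del]

lemma less_list_encode: "x \<in> set xs \<Longrightarrow> x < list_encode xs"
proof (induction xs)
  case (Cons y ys)
  then show ?case using le_prod_encode_1[of y "list_encode ys"] le_prod_encode_2[of "list_encode ys" y]
    by (auto simp: less_Suc_eq_le intro: order.trans less_imp_le)
qed simp

lemma code_hd_Cons [simp]: "code_hd (list_encode (x # xs)) = x"
  and code_tl_Cons [simp]: "code_tl (list_encode (x # xs)) = list_encode xs"
  by (simp_all add: code_hd_def code_tl_def)

lemma dec_enc_term: "dec_term (enc_trm t) = t"
proof (induction t)
  case (Scal c t)
  have "enc_trm t < enc_trm (Scal c t)" by (simp del: list_encode.simps add: less_list_encode)
  then show ?case using Scal
    by (subst dec_term.simps) (simp del: list_encode.simps add: Let_def dec_enc_rat)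
next
  case (Plus s t)
  have "enc_trm s < enc_trm (Plus s t)" "enc_trm t < enc_trm (Plus s t)"
    by (simp_all del: list_encode.simps add: less_list_encode)
  then show ?case using Plus
    by (subst dec_term.simps) (simp del: list_encode.simps add: Let_def)
next
  case (Times s t)
  have "enc_trm s < enc_trm (Times s t)" "enc_trm t < enc_trm (Times s t)"
    by (simp_all del: list_encode.simps add: less_list_encode)
  then show ?case using Times
    by (subst dec_term.simps) (simp del: list_encode.simps add: Let_def)
qed (subst dec_term.simps; simp del: list_encode.simps add: Let_def)+

instantiation trm :: numbered
begin
definition dec_trm :: "nat \<Rightarrow> trm" where "dec_trm = dec_term"
instance
proof
  have "t = dec (enc_trm t)" for t :: trm by (simp add: dec_trm_def dec_enc_term)
  then show "surj (dec :: nat \<Rightarrow> trm)" unfolding surj_def by blast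
qed
end

text \<open>A realizer in the sense of numbered sets: \<open>F\<close> may return any code of the
  value. Everything is total, so partial operations appear below with default values.\<close>

definition computable :: "('a :: numbered \<Rightarrow> 'b :: numbered) \<Rightarrow> bool" where
  "computable f \<longleftrightarrow> (\<exists>F. recursive F \<and> (\<forall>c. dec (F c) = f (dec c)))"

named_theorems comp_intros

lemma computableI: "recursive F \<Longrightarrow> (\<And>c. dec (F c) = f (dec c)) \<Longrightarrow> computable f"
  unfolding computable_def by blast

lemma computableE:
  assumes "computable f"
  obtains F where "recursive F" "\<And>c. dec (F c) = f (dec c)"
  using assms unfolding computable_def by blast

lemma computable_id [comp_intros]: "computable (\<lambda>e. e)"
  by (rule computableI[OF recursive_id]) simp

lemma computable_const [comp_intros]: "computable (\<lambda>_. a)"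
proof -
  obtain c where "a = dec c" using surj_dec by (meson surjD)
  then show ?thesis by (intro computableI[OF recursive_const[of c]]) simp
qed

lemma computable_compose:
  assumes "computable f" "computable g"
  shows "computable (\<lambda>e. f (g e))"
  using assms by (elim computableE) (rule computableI[OF recursive_compose], assumption+, simp)

text \<open>If \<open>'a\<close> is numbered through representatives in \<open>'b\<close>, a
  function on \<open>'a\<close> may be computed on representatives. The next lemma is the
  counterpart for results: it suffices to compute a representative.\<close>

lemma computable_quotient:
  fixes f :: "'a :: numbered \<Rightarrow> 'c :: numbered" and \<phi> :: "'b :: numbered \<Rightarrow> 'a"
  assumes "\<And>c. (dec c :: 'a) = \<phi> (dec c)" "computable (\<lambda>x. f (\<phi> x))"
  shows "computable f"
  using assms by (auto simp: computable_def)

lemma computable_quotient_map: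
  fixes \<phi> :: "'b :: numbered \<Rightarrow> 'a :: numbered"
  assumes "\<And>c. (dec c :: 'a) = \<phi> (dec c)" "computable g"
  shows "computable (\<lambda>e. \<phi> (g e))"
  using assms by (auto simp: computable_def)

lemma computable_Pair [comp_intros]:
  assumes "computable f" "computable g"
  shows "computable (\<lambda>e. (f e, g e))"
  using assms
  by (elim computableE) (rule computableI[OF recursive_arith(4)], assumption+, simp add: dec_prod_def)

lemma computable_fst [comp_intros]: "computable f \<Longrightarrow> computable (\<lambda>e. fst (f e))"
  by (elim computableE) (rule computableI[OF recursive_unary(2)], assumption+, metis dec_prod_def fst_conv)

lemma computable_snd [comp_intros]: "computable f \<Longrightarrow> computable (\<lambda>e. snd (f e))"
  by (elim computableE) (rule computableI[OF recursive_unary(3)], assumption+, metis dec_prod_def snd_conv)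

lemma computable_compose2:
  assumes "computable (\<lambda>p. h (fst p) (snd p))" "computable f" "computable g"
  shows "computable (\<lambda>e. h (f e) (g e))"
  using computable_compose[OF assms(1) computable_Pair[OF assms(2,3)]] by simp

lemma computable_dec [comp_intros]: "computable f \<Longrightarrow> computable (\<lambda>e. dec (f e))"
  by (auto simp: computable_def dec_nat_def)

lemma computable_Suc [comp_intros]: "computable f \<Longrightarrow> computable (\<lambda>e. Suc (f e))"
  by (elim computableE) (rule computableI[OF recursive_unary(1)], assumption, simp add: dec_nat_def)

lemma computable_nat_arith [comp_intros]:
  fixes f g :: "'e :: numbered \<Rightarrow> nat"
  assumes "computable f" "computable g"
  shows "computable (\<lambda>e. f e + g e)" "computable (\<lambda>e. f e - g e)" "computable (\<lambda>e. f e * g e)"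
proof -
  obtain F where "recursive F" "\<And>c. dec (F c) = f (dec c)"
    using assms(1) by (auto elim!: computableE)
  moreover obtain G where "recursive G" "\<And>c. dec (G c) = g (dec c)"
    using assms(2) by (auto elim!: computableE)
  ultimately show "computable (\<lambda>e. f e + g e)" "computable (\<lambda>e. f e - g e)" "computable (\<lambda>e. f e * g e)"
    by (auto intro: computableI[OF recursive_arith(1)] computableI[OF recursive_arith(2)]
        computableI[OF recursive_arith(3)] simp: dec_nat_def)
qed

lemma computable_rec_nat [comp_intros]:
  fixes g :: "'e :: numbered \<Rightarrow> nat \<Rightarrow> 'b \<Rightarrow> 'b :: numbered"
  assumes "computable a" "computable (\<lambda>p. g (fst p) (fst (snd p)) (snd (snd p)))" "computable m"
  shows "computable (\<lambda>e. rec_nat (a e) (g e) (m e))"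
proof -
  obtain A where A: "recursive A" "\<And>c. dec (A c) = a (dec c)"
    using assms(1) by (auto elim!: computableE)
  obtain G where G: "recursive G"
    "\<And>c. dec (G c) = (\<lambda>p. g (fst p) (fst (snd p)) (snd (snd p))) (dec c)"
    using assms(2) by (auto elim!: computableE)
  obtain M where M: "recursive M" "\<And>c. dec (M c) = m (dec c)"
    using assms(3) by (auto elim!: computableE)
  define H where "H c i r = G (prod_encode (c, prod_encode (i, r)))" for c i r
  have "recursive (\<lambda>c. rec_nat (A c) (H c) (M c))"
    by (rule recursive_rec_nat) (simp_all add: A G M H_def)
  moreover have "dec (rec_nat (A c) (H c) i) = rec_nat (a (dec c)) (g (dec c)) i" for c i
    by (induction i) (simp_all add: A H_def G dec_prod_def dec_nat_def)
  ultimately show ?thesis using M(2) by (intro computableI) (simp_all add: dec_nat_def)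
qed

lemma computable_If [comp_intros]:
  assumes "computable b" "computable f" "computable g"
  shows "computable (\<lambda>e. if b e then f e else g e)"
proof -
  obtain B where B: "recursive B" "\<And>c. dec (B c) = b (dec c)"
    using assms(1) by (auto elim!: computableE)
  obtain F where F: "recursive F" "\<And>c. dec (F c) = f (dec c)"
    using assms(2) by (auto elim!: computableE)
  obtain G where G: "recursive G" "\<And>c. dec (G c) = g (dec c)"
    using assms(3) by (auto elim!: computableE)
  \<comment> \<open>A recursion whose step ignores counter and accumulator distinguishes 0 from the
    positive codes, that is, \<open>False\<close> from \<open>True\<close>.\<close>
  have "recursive (\<lambda>c. rec_nat (G c) (\<lambda>_ _. F c) (B c))"
    by (intro recursive_rec_nat recursive_compose[OF F(1)] recursive_arith recursive_unary recursive_id F G B)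
  moreover have "rec_nat x (\<lambda>_ _. y) i = (if i \<noteq> 0 then y else x)" for x y :: nat and i
    by (cases i) simp_all
  ultimately show ?thesis using B(2) F(2) G(2)
    by (intro computableI[of "\<lambda>c. rec_nat (G c) (\<lambda>_ _. F c) (B c)"]) (simp_all add: dec_bool_def)
qed

lemma computable_eq_0: "computable f \<Longrightarrow> computable (\<lambda>e. f e = (0 :: nat))"
proof (elim computableE)
  fix F assume F: "recursive F" "\<And>c. dec (F c) = f (dec c)"
  have "recursive (\<lambda>c. 1 - F c)" by (intro recursive_arith recursive_unary recursive_const F)
  then show ?thesis by (rule computableI) (auto simp: dec_bool_def dec_nat_def simp flip: F(2))
qed

lemma computable_not [comp_intros]: "computable b \<Longrightarrow> computable (\<lambda>e. \<not> b e)"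
  using computable_If[of b "\<lambda>_. False" "\<lambda>_. True"] by (simp add: computable_const if_bool_eq_conj)

lemma computable_conj [comp_intros]:
  "computable b \<Longrightarrow> computable c \<Longrightarrow> computable (\<lambda>e. b e \<and> c e)"
  using computable_If[of b c "\<lambda>_. False"] by (simp add: computable_const if_bool_eq_disj)

lemma computable_disj [comp_intros]:
  "computable b \<Longrightarrow> computable c \<Longrightarrow> computable (\<lambda>e. b e \<or> c e)"
  using computable_not[OF computable_conj[OF computable_not computable_not]] by fastforce

lemma computable_le [comp_intros]:
  fixes f g :: "'e :: numbered \<Rightarrow> nat"
  assumes "computable f" "computable g"
  shows "computable (\<lambda>e. f e \<le> g e)"
  using computable_eq_0[OF computable_nat_arith(2)[OF assms]] by simp

lemma computable_less [comp_intros]: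
  fixes f g :: "'e :: numbered \<Rightarrow> nat"
  assumes "computable f" "computable g"
  shows "computable (\<lambda>e. f e < g e)"
  using computable_not[OF computable_le[OF assms(2,1)]] by (simp add: not_le)

lemma computable_eq_nat [comp_intros]:
  fixes f g :: "'e :: numbered \<Rightarrow> nat"
  assumes "computable f" "computable g"
  shows "computable (\<lambda>e. f e = g e)"
  unfolding eq_iff[of "f _"] by (intro comp_intros assms)

lemma computable_all_less [comp_intros]:
  assumes "computable m" "computable (\<lambda>p. b (fst p) (snd p))"
  shows "computable (\<lambda>e. \<forall>i < m e :: nat. b e i)"
proof -
  have "(\<forall>i < n. b e i) = rec_nat True (\<lambda>i r. r \<and> b e i) n" for e n
    by (induction n) (auto simp: less_Suc_eq)
  then show ?thesis
    by (auto intro!: comp_intros assms(1) computable_compose2[OF assms(2)])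
qed

lemma computable_power [comp_intros]:
  fixes f g :: "'e :: numbered \<Rightarrow> nat"
  assumes "computable f" "computable g"
  shows "computable (\<lambda>e. f e ^ g e)"
proof -
  have "m ^ n = rec_nat 1 (\<lambda>i r. r * m) n" for m n :: nat by (induction n) auto
  then show ?thesis by (auto intro!: comp_intros assms(2) computable_compose[OF assms(1)])
qed

lemma computable_mod_div:
  "computable (\<lambda>p. (fst p mod snd p, fst p div snd p) :: nat \<times> nat)"
proof -
  define g where "g n q = (if n = 0 then q else if Suc (fst q) = n then (0, Suc (snd q)) else (Suc (fst q), snd q))"
    for n :: nat and q :: "nat \<times> nat"
  have "(m mod n, m div n) = rec_nat (0, 0) (\<lambda>i q. g n q) m" if "n \<noteq> 0" for m n :: nat
    using that
  proof (induction m)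
    case (Suc m)
    have "rec_nat (0, 0) (\<lambda>i q. g n q) (Suc m) = g n (m mod n, m div n)" using Suc by simp
    then show ?case using Suc.prems by (auto simp: g_def mod_Suc div_Suc)
  qed simp
  \<comment> \<open>The counting loop never wraps around for \<open>n = 0\<close>; the conventions
    \<open>m mod 0 = m\<close> and \<open>m div 0 = 0\<close> are put in by hand.\<close>
  then have eq: "(m mod n, m div n) = (if n = 0 then (m, 0) else rec_nat (0, 0) (\<lambda>i q. g n q) m)" for m n
    by simp
  show ?thesis unfolding eq g_def by (intro comp_intros)
qed

lemma computable_mod [comp_intros]:
  fixes f g :: "'e :: numbered \<Rightarrow> nat"
  assumes "computable f" "computable g"
  shows "computable (\<lambda>e. f e mod g e)"
  using computable_fst[OF computable_compose[OF computable_mod_div computable_Pair[OF assms]]] by simp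

lemma computable_div [comp_intros]:
  fixes f g :: "'e :: numbered \<Rightarrow> nat"
  assumes "computable f" "computable g"
  shows "computable (\<lambda>e. f e div g e)"
  using computable_snd[OF computable_compose[OF computable_mod_div computable_Pair[OF assms]]] by simp

lemma dec_list_0: "dec 0 = ([] :: 'a :: numbered list)"
  and dec_list_Suc: "dec (Suc c) = (dec (fst (prod_decode c)) # dec (snd (prod_decode c)) :: 'a list)"
  by (simp_all add: dec_list_def split: prod.splits)

lemma computable_Cons [comp_intros]:
  assumes "computable f" "computable g"
  shows "computable (\<lambda>e. f e # g e)"
  using assms
  by (auto elim!: computableE)
    (rule computableI[OF recursive_unary(1)[OF recursive_arith(4)]], assumption+, simp add: dec_list_Suc)

lemma computable_Nil_iff:
  fixes f :: "'e :: numbered \<Rightarrow> 'b :: numbered list"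
  assumes "computable f" shows "computable (\<lambda>e. f e = [])"
proof -
  have "computable (\<lambda>l :: 'b list. l = [])"
  proof (rule computable_quotient[where \<phi> = "dec :: nat \<Rightarrow> 'b list"])
    have "(dec c = ([] :: 'b list)) = (c = 0)" for c
      by (cases c) (simp_all add: dec_list_0 dec_list_Suc)
    then show "computable (\<lambda>x. dec x = ([] :: 'b list))" by (simp add: comp_intros)
  qed (simp add: dec_nat_def)
  from computable_compose[OF this assms] show ?thesis .
qed

lemma computable_tl [comp_intros]:
  fixes f :: "'e :: numbered \<Rightarrow> 'b :: numbered list"
  assumes "computable f" shows "computable (\<lambda>e. tl (f e))"
  using assms
proof (elim computableE)
  fix F assume F: "recursive F" "\<And>c. dec (F c) = f (dec c)"
  \<comment> \<open>The empty list has code 0. Truncated subtraction keeps it at 0, and the second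
    component of \<open>prod_decode 0\<close> is again 0, so one formula also covers
    \<open>tl [] = []\<close>.\<close>
  have tl: "dec (snd (prod_decode (c - 1))) = (tl (dec c) :: 'b list)" for c
  proof (cases c)
    case 0
    moreover have "prod_decode 0 = (0, 0)" by (simp add: prod_decode_def prod_decode_aux.simps)
    ultimately show ?thesis by (simp add: dec_list_0)
  qed (simp add: dec_list_Suc)
  have "recursive (\<lambda>c. snd (prod_decode (F c - 1)))"
    by (intro recursive_arith recursive_unary recursive_const F)
  then show ?thesis by (rule computableI) (simp only: tl F)
qed

definition hdd :: "'a \<Rightarrow> 'a list \<Rightarrow> 'a" where
  "hdd d l = (case l of [] \<Rightarrow> d | x # xs \<Rightarrow> x)"

lemma computable_hdd [comp_intros]:
  fixes d :: "'e :: numbered \<Rightarrow> 'b :: numbered"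
  assumes "computable d" "computable f"
  shows "computable (\<lambda>e. hdd (d e) (f e))"
proof -
  obtain F where F: "recursive F" "\<And>c. dec (F c) = f (dec c)" using assms(2) by (auto elim!: computableE)
  obtain D where D: "recursive D" "\<And>c. dec (D c) = d (dec c)" using assms(1) by (auto elim!: computableE)
  have "recursive (\<lambda>c. rec_nat (D c) (\<lambda>i _. fst (prod_decode i)) (F c))"
    by (intro recursive_rec_nat recursive_arith recursive_unary recursive_id F D)
  moreover have hdd: "dec (rec_nat x (\<lambda>i _. fst (prod_decode i)) y) = (hdd (dec x) (dec y) :: 'b)" for x y
    by (cases y) (simp_all add: hdd_def dec_list_0 dec_list_Suc)
  ultimately show ?thesis by (intro computableI) (assumption, simp only: hdd F D)
qed

text \<open>List access with a specified value outside the range, written as an iteration of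
  \<open>tl\<close> so that the closure rules apply.\<close>

definition nthd :: "'a \<Rightarrow> 'a list \<Rightarrow> nat \<Rightarrow> 'a" where
  "nthd d l i = hdd d (rec_nat l (\<lambda>_. tl) i)"

lemma nthd_eq: "nthd d l i = (if i < length l then l ! i else d)"
proof -
  have "rec_nat l (\<lambda>_. tl) i = drop i l" by (induction i) (simp_all add: drop_Suc tl_drop)
  moreover have "hdd d (drop i l) = (if i < length l then l ! i else d)"
    by (cases "i < length l") (simp_all add: hdd_def Cons_nth_drop_Suc[symmetric])
  ultimately show ?thesis by (simp add: nthd_def)
qed

lemma computable_nthd [comp_intros]:
  assumes "computable d" "computable f" "computable i"
  shows "computable (\<lambda>e. nthd (d e) (f e) (i e))"
  unfolding nthd_def by (intro comp_intros assms)

text \<open>A list is no longer than any of its codes. The code therefore bounds a recursion that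
  counts the nonempty tails; the count does not depend on which code was given.\<close>

lemma computable_length [comp_intros]:
  fixes f :: "'e :: numbered \<Rightarrow> 'b :: numbered list"
  assumes "computable f" shows "computable (\<lambda>e. length (f e))"
proof -
  have l: "length l \<le> c" if "l = (dec c :: 'b list)" for l c
    using that 
  proof (induction l arbitrary: c)
    case (Cons x l)
    then obtain c' where c: "c = Suc c'" by (cases c) (auto simp: dec_list_0)
    then have "l = dec (snd (prod_decode c'))" using Cons.prems by (simp add: dec_list_Suc)
    from Cons.IH[OF this] show ?case unfolding c
      by (metis length_Cons Suc_le_mono le_prod_encode_2 le_trans prod.collapse prod_decode_inverse)
  qed simp
  have eq: "length l = rec_nat 0 (\<lambda>i r. if rec_nat l (\<lambda>_. tl) i = [] then r else Suc r) c" if "length l \<le> c" for l :: "'b list" and c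
  proof -
    have d: "rec_nat l (\<lambda>_. tl) i = drop i l" for i by (induction i) (simp_all add: drop_Suc tl_drop)
    have "rec_nat 0 (\<lambda>i r. if rec_nat l (\<lambda>_. tl) i = [] then r else Suc r) i = min i (length l)" for i
      unfolding d by (induction i) (auto simp: min_def)
    then show ?thesis using that by simp
  qed
  have "computable (\<lambda>l :: 'b list. length l)"
  proof (rule computable_quotient[where \<phi> = "dec :: nat \<Rightarrow> 'b list"])
    show "computable (\<lambda>c. length (dec c :: 'b list))"
      unfolding eq[OF l[OF refl]] by (intro comp_intros computable_Nil_iff)
  qed (simp add: dec_nat_def)
  from computable_compose[OF this assms] show ?thesis .
qed

lemma computable_fold [comp_intros]:
  fixes g :: "'e :: numbered \<Rightarrow> 'a :: numbered \<Rightarrow> 'b \<Rightarrow> 'b :: numbered"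
  assumes "computable (\<lambda>p. g (fst p) (fst (snd p)) (snd (snd p)))" "computable l" "computable a"
  shows "computable (\<lambda>e. fold (g e) (l e) (a e))"
proof -
  \<comment> \<open>All lookups stay below the length of the list, so this default is never
    returned.\<close>
  define d :: 'a where "d = undefined"
  define h where "h e l i r = g e (nthd d l i) r" for e l i r
  have eq: "fold (g e) l a = rec_nat a (h e l) (length l)" for e l a
  proof (induction l rule: rev_induct)
    case (snoc x l)
    have "rec_nat a (h e (l @ [x])) i = rec_nat a (h e l) i" if "i \<le> length l" for i
      using that by (induction i) (auto simp: h_def nthd_eq nth_append)
    then show ?case using snoc by (simp add: h_def[of _ _ "length l"] nthd_eq)
  qed simp
  have "computable (\<lambda>p. h (fst p) (l (fst p)) (fst (snd p)) (snd (snd p)))"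
  proof -
    have "computable (\<lambda>p :: 'e \<times> nat \<times> 'b. (fst p, nthd d (l (fst p)) (fst (snd p)), snd (snd p)))"
      by (intro comp_intros computable_compose[OF assms(2)])
    from computable_compose[OF assms(1) this] show ?thesis by (simp add: h_def)
  qed
  from computable_rec_nat[OF assms(3) this computable_length[OF assms(2)]]
  show ?thesis unfolding eq .
qed

lemma computable_ball [comp_intros]:
  assumes "computable l" "computable (\<lambda>p. b (fst p) (snd p))"
  shows "computable (\<lambda>e. \<forall>x \<in> set (l e). b e x)"
proof -
  have eq: "(\<forall>x \<in> set xs. b e x) = fold (\<lambda>x r. r \<and> b e x) xs True" for e xs
    by (induction xs rule: rev_induct) auto
  show ?thesis
    unfolding eq by (intro comp_intros assms(1) computable_compose2[OF assms(2)])
qed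

section \<open>Arithmetic of integers and rationals\<close>

lemma computable_int_diff: 
  assumes "computable f" "computable g"
  shows "computable (\<lambda>e. int (f e) - int (g e))"
proof -
  \<comment> \<open>\<open>int_decode\<close> sends the even code 2j to j and the odd code 2j - 1 to
    -j.\<close>
  have eq: "int m - int n = int_decode (if n \<le> m then 2 * (m - n) else 2 * (n - m) - 1)" for m n
    by (auto simp: int_decode_def sum_decode_def)
  show ?thesis
    unfolding eq
    by (rule computable_quotient_map[where \<phi> = int_decode]) (simp add: dec_int_def dec_nat_def, intro comp_intros assms)
qed

lemma computable_nat_of_int:
  assumes "computable f"
  shows "computable (\<lambda>e. nat (f e))" "computable (\<lambda>e. nat (- f e))"
proof -
  have eq: "nat (int_decode c) = (if c mod 2 = 0 then c div 2 else 0)"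
    "nat (- int_decode c) = (if c mod 2 = 0 then 0 else Suc (c div 2))" for c
    by (auto simp: int_decode_def sum_decode_def mod_2_eq_odd)
  have "computable nat"
    by (rule computable_quotient[where \<phi> = int_decode])
      (simp add: dec_int_def dec_nat_def, unfold eq, intro comp_intros)
  from computable_compose[OF this assms] show "computable (\<lambda>e. nat (f e))" .
  have "computable (\<lambda>i. nat (- i))"
    by (rule computable_quotient[where \<phi> = int_decode])
      (simp add: dec_int_def dec_nat_def, unfold eq, intro comp_intros)
  from computable_compose[OF this assms] show "computable (\<lambda>e. nat (- f e))" .
qed

lemma computable_int_arith [comp_intros]:
  fixes f g :: "'e :: numbered \<Rightarrow> int"
  assumes "computable f" "computable g"
  shows "computable (\<lambda>e. f e + g e)" "computable (\<lambda>e. f e * g e)"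
proof -
  have split: "i = int (nat i) - int (nat (- i))" for i by simp
  have add: "i + j = int (nat i + nat j) - int (nat (- i) + nat (- j))" for i j by simp
  have mult: "i * j = int (nat i * nat j + nat (- i) * nat (- j)) - int (nat i * nat (- j) + nat (- i) * nat j)"
    for i j
    by (subst split[of i], subst split[of j]) (simp add: algebra_simps del: of_nat_nat)
  show "computable (\<lambda>e. f e + g e)" "computable (\<lambda>e. f e * g e)"
    unfolding add mult
    by (intro comp_intros computable_int_diff computable_nat_of_int assms)+
qed

lemma computable_int_eq_0: 
  assumes "computable f"
  shows "computable (\<lambda>e. f e = (0 :: int))"
proof -
  have eq: "i = 0 \<longleftrightarrow> nat i = 0 \<and> nat (- i) = 0" for i :: int by auto
  show ?thesis unfolding eq by (intro comp_intros computable_nat_of_int assms)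
qed

lemma computable_quot: "computable f \<Longrightarrow> computable (\<lambda>e. quot (f e))"
  by (rule computable_quotient_map) (simp_all add: dec_rat_def)

lemma computable_rat_binop:
  fixes h :: "rat \<Rightarrow> rat \<Rightarrow> rat"
  assumes "computable (\<lambda>p. h (quot (fst p)) (quot (snd p)))" "computable f" "computable g"
  shows "computable (\<lambda>e. h (f e) (g e))"
proof (rule computable_compose2[OF _ assms(2,3)])
  show "computable (\<lambda>p. h (fst p) (snd p))"
    by (rule computable_quotient[where \<phi> = "map_prod quot quot"])
      (simp_all add: dec_prod_def dec_rat_def assms(1))
qed

lemma computable_rat_arith [comp_intros]:
  fixes f g :: "'e :: numbered \<Rightarrow> rat"
  assumes "computable f" "computable g"
  shows "computable (\<lambda>e. f e + g e)" "computable (\<lambda>e. f e * g e)"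
proof -
  \<comment> \<open>A pair with denominator 0 represents 0. The formula for sums of fractions fails
    on such pairs, which are therefore treated first; the formula for products remains
    correct.\<close>
  have add: "quot p + quot q = quot (if snd p = 0 then q else if snd q = 0 then p
      else (fst p * snd q + fst q * snd p, snd p * snd q))" for p q
    by (simp add: quot_def add_frac_eq)
  have mult: "quot p * quot q = quot (fst p * fst q, snd p * snd q)" for p q
    by (simp add: quot_def)
  show "computable (\<lambda>e. f e + g e)"
    by (rule computable_rat_binop[OF _ assms])
      (unfold add, intro comp_intros computable_quot computable_int_eq_0)
  show "computable (\<lambda>e. f e * g e)"
    by (rule computable_rat_binop[OF _ assms])
      (unfold mult, intro comp_intros computable_quot)
qed

lemma computable_rat_eq_0:
  assumes "computable f"
  shows "computable (\<lambda>e. f e = (0 :: rat))"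
proof -
  have eq: "quot p = 0 \<longleftrightarrow> fst p = 0 \<or> snd p = 0" for p by (simp add: quot_def)
  have "computable (\<lambda>q :: rat. q = 0)"
    by (rule computable_quotient[where \<phi> = quot])
      (simp add: dec_rat_def, unfold eq, intro comp_intros computable_int_eq_0)
  from computable_compose[OF this assms] show ?thesis .
qed

lemma computable_rat_eq [comp_intros]:
  fixes f g :: "'e :: numbered \<Rightarrow> rat"
  assumes "computable f" "computable g"
  shows "computable (\<lambda>e. f e = g e)"
proof -
  have eq: "x = y \<longleftrightarrow> x + (- 1) * y = 0" for x y :: rat by auto
  show ?thesis unfolding eq[of "f _"] by (intro comp_intros computable_rat_eq_0 assms)
qed

lemma computable_rat_of_nat [comp_intros]:
  assumes "computable f"
  shows "computable (\<lambda>e. of_nat (f e) :: rat)"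
proof -
  have eq: "(of_nat n :: rat) = quot (int n - int 0, 1)" for n by (simp add: quot_def)
  show ?thesis unfolding eq by (intro comp_intros computable_quot computable_int_diff assms)
qed

section \<open>Constructors of terms and recursion over terms\<close>

lemma computable_list_encode [comp_intros]: "computable f \<Longrightarrow> computable (\<lambda>e. list_encode (f e))"
  by (rule computable_compose[where f = list_encode])
    (auto intro!: computableI[OF recursive_id] simp: dec_nat_def dec_list_def map_idI)

text \<open>This holds for arbitrary codes \<open>a\<close> and \<open>b\<close>, not only for
  values of \<open>enc_trm\<close>; hence the constructors can be computed directly on
  codes.\<close>

lemma dec_term_list_encode:
  "dec_term (list_encode [0, a]) = Var a"
  "dec_term (list_encode [2, a, b]) = Scal (dec a) (dec_term b)"
  "dec_term (list_encode [3, a, b]) = Plus (dec_term a) (dec_term b)"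
  "dec_term (list_encode [4, a, b]) = Times (dec_term a) (dec_term b)"
proof -
  have less: "a < list_encode [t, a, b]" "b < list_encode [t, a, b]" for t
    by (simp_all del: list_encode.simps add: less_list_encode)
  show "dec_term (list_encode [0, a]) = Var a"
    by (subst dec_term.simps) (simp del: list_encode.simps add: Let_def)
  show "dec_term (list_encode [2, a, b]) = Scal (dec a) (dec_term b)"
    by (subst dec_term.simps) (simp del: list_encode.simps add: Let_def less)
  show "dec_term (list_encode [3, a, b]) = Plus (dec_term a) (dec_term b)"
    by (subst dec_term.simps) (simp del: list_encode.simps add: Let_def less)
  show "dec_term (list_encode [4, a, b]) = Times (dec_term a) (dec_term b)"
    by (subst dec_term.simps) (simp del: list_encode.simps add: Let_def less)
qed

lemma computable_Var [comp_intros]: "computable f \<Longrightarrow> computable (\<lambda>e. Var (f e))"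
  unfolding dec_term_list_encode(1)[symmetric]
  by (rule computable_quotient_map[where \<phi> = dec_term])
    (simp add: dec_trm_def dec_nat_def, intro comp_intros)

lemma computable_pair_quotient:
  fixes h :: "'a :: numbered \<Rightarrow> 'b :: numbered \<Rightarrow> 'c :: numbered"
  assumes "computable (\<lambda>p. h (dec (fst p)) (dec (snd p)))" "computable f" "computable g"
  shows "computable (\<lambda>e. h (f e) (g e))"
proof (rule computable_compose2[OF _ assms(2,3)])
  show "computable (\<lambda>p. h (fst p) (snd p))"
    by (rule computable_quotient[where \<phi> = "map_prod dec dec"])
      (simp_all add: dec_prod_def dec_nat_def map_prod_def split_beta assms(1))
qed

lemma computable_trm_constructors [comp_intros]:
  assumes "computable t"
  shows "computable c \<Longrightarrow> computable (\<lambda>e. Scal (c e) (t e))"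
    "computable s \<Longrightarrow> computable (\<lambda>e. Plus (s e) (t e))"
    "computable s \<Longrightarrow> computable (\<lambda>e. Times (s e) (t e))"
proof -
  have *: "computable f \<Longrightarrow> computable (\<lambda>e. dec_term (f e))" for f :: "nat \<times> nat \<Rightarrow> nat"
    using computable_dec[of f, where ?'b = trm] by (simp add: dec_trm_def)
  show "computable (\<lambda>e. Scal (c e) (t e))" if "computable c"
    by (rule computable_pair_quotient[OF _ that assms])
      (unfold dec_trm_def dec_term_list_encode[symmetric], intro * comp_intros)
  show "computable (\<lambda>e. Plus (s e) (t e))" if "computable s"
    by (rule computable_pair_quotient[OF _ that assms])
      (unfold dec_trm_def dec_term_list_encode[symmetric], intro * comp_intros)
  show "computable (\<lambda>e. Times (s e) (t e))" if "computable s"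
    by (rule computable_pair_quotient[OF _ that assms])
      (unfold dec_trm_def dec_term_list_encode[symmetric], intro * comp_intros)
qed

lemma computable_code_hd_tl [comp_intros]:
  assumes "computable f"
  shows "computable (\<lambda>e. code_hd (f e))" "computable (\<lambda>e. code_tl (f e))"
proof -
  have "computable code_hd"
    unfolding code_hd_def
    by (rule computableI[of "\<lambda>c. fst (prod_decode (c - 1))"])
      (intro recursive_unary recursive_arith recursive_id recursive_const, simp add: dec_nat_def)
  from computable_compose[OF this assms] show "computable (\<lambda>e. code_hd (f e))" .
  have "computable code_tl"
    unfolding code_tl_def
    by (rule computableI[of "\<lambda>c. snd (prod_decode (c - 1))"])
      (intro recursive_unary recursive_arith recursive_id recursive_const, simp add: dec_nat_def)
  from computable_compose[OF this assms] show "computable (\<lambda>e. code_tl (f e))" .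
qed

text \<open>Course-of-values recursion: \<open>tbl e c\<close> lists the values of \<open>h e\<close> at the terms coded by
  \<open>c - 1, \<dots>, 0\<close>.\<close>

lemma computable_trm_rec:
  fixes h :: "'e :: numbered \<Rightarrow> trm \<Rightarrow> 'b :: numbered"
  assumes h: "\<And>e x. h e (Var x) = fv e x" "\<And>e. h e Zero = fz e"
    "\<And>e c t. h e (Scal c t) = fs e c t (h e t)"
    "\<And>e s t. h e (Plus s t) = fp e s t (h e s) (h e t)"
    "\<And>e s t. h e (Times s t) = ft e s t (h e s) (h e t)"
    and "computable (\<lambda>p. fv (fst p) (snd p))" "computable fz"
    "computable (\<lambda>p. fs (fst p) (fst (snd p)) (fst (snd (snd p))) (snd (snd (snd p))))"
    "computable (\<lambda>p. fp (fst p) (fst (snd p)) (fst (snd (snd p))) (fst (snd (snd (snd p)))) (snd (snd (snd (snd p)))))"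
    "computable (\<lambda>p. ft (fst p) (fst (snd p)) (fst (snd (snd p))) (fst (snd (snd (snd p)))) (snd (snd (snd (snd p)))))"
    and "computable f" "computable g"
  shows "computable (\<lambda>e. h (f e) (g e))"
proof (rule computable_compose2[OF _ assms(11,12)], rule computable_quotient[where \<phi> = "map_prod id (dec :: nat \<Rightarrow> trm)"])
  show "(dec c :: 'e \<times> trm) = map_prod id dec (dec c)" for c
    by (simp add: dec_prod_def dec_nat_def)
  define d :: 'b where "d = undefined"
  define G where "G e c r = (let t = code_hd c; a = code_hd (code_tl c); b = code_hd (code_tl (code_tl c)) in
     if t = 0 then fv e a
     else if t = 2 \<and> b < c then fs e (dec a) (dec b) (nthd d r (c - Suc b))
     else if t = 3 \<and> a < c \<and> b < c then fp e (dec a) (dec b) (nthd d r (c - Suc a)) (nthd d r (c - Suc b))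
     else if t = 4 \<and> a < c \<and> b < c then ft e (dec a) (dec b) (nthd d r (c - Suc a)) (nthd d r (c - Suc b))
     else fz e)" for e c r
  define tbl where "tbl e c = rec_nat [] (\<lambda>i r. G e i r # r) c" for e c
  have G: "G e c (map (\<lambda>j. h e (dec j)) (rev [0..<c])) = h e (dec c)" for e c
  proof -
    define L where "L = map (\<lambda>j. h e (dec j)) (rev [0..<c])"
    \<comment> \<open>The table starts with the latest value, so the value at code \<open>j\<close>
      stands at position \<open>c - Suc j\<close>.\<close>
    have lk: "nthd d L (c - Suc j) = h e (dec j)" if "j < c" for j
      using that by (simp add: L_def nthd_eq rev_nth)
    show ?thesis
      using dec_term.simps[of c]
      by (simp add: G_def Let_def h lk dec_trm_def[symmetric] L_def[symmetric] split: if_splits)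
  qed
  have tbl: "tbl e c = map (\<lambda>j. h e (dec j)) (rev [0..<c])" for e c
    by (induction c) (simp_all add: tbl_def G)
  have eq: "h (fst (map_prod id dec p)) (snd (map_prod id dec p)) = G (fst p) (snd p) (tbl (fst p) (snd p))" for p
    by (simp add: tbl G)
  have G_comp: "computable (\<lambda>p. G (x p) (y p) (z p))"
    if "computable x" "computable y" "computable z" for x :: "'f :: numbered \<Rightarrow> 'e" and y z
  proof -
    have fv: "computable (\<lambda>p. fv (x p) (y p))" if "computable x" "computable y" 
      for x :: "'f \<Rightarrow> 'e" and y
      using computable_compose[OF assms(6), of "\<lambda>p. (x p, y p)"] that by (simp add: comp_intros)
    have fz: "computable (\<lambda>p. fz (x p))" using computable_compose[OF assms(7)] that by blast
    have fs: "computable (\<lambda>p. fs (x p) (y p) (z p) (w p))"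
      if "computable x" "computable y" "computable z" "computable w" 
      for x :: "'f \<Rightarrow> 'e" and y z w
      using computable_compose[OF assms(8), of "\<lambda>p. (x p, y p, z p, w p)"] that by (simp add: comp_intros)
    have fp: "computable (\<lambda>p. fp (x p) (y p) (z p) (w p) (v p))"
      if "computable x" "computable y" "computable z" "computable w" "computable v"
      for x :: "'f \<Rightarrow> 'e" and y z w v
      using computable_compose[OF assms(9), of "\<lambda>p. (x p, y p, z p, w p, v p)"] that by (simp add: comp_intros)
    have ft: "computable (\<lambda>p. ft (x p) (y p) (z p) (w p) (v p))"
      if "computable x" "computable y" "computable z" "computable w" "computable v"
      for x :: "'f \<Rightarrow> 'e" and y z w v
      using computable_compose[OF assms(10), of "\<lambda>p. (x p, y p, z p, w p, v p)"] that by (simp add: comp_intros)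
    show ?thesis unfolding G_def Let_def by (intro comp_intros fv fz fs fp ft that)
  qed
  show "computable (\<lambda>p. h (fst (map_prod id dec p)) (snd (map_prod id dec p)))"
    unfolding eq tbl_def by (intro G_comp comp_intros)
qed

section \<open>Semidecidable predicates\<close>

lemma ex_dec: "(\<exists>m. P (dec m :: 'a :: numbered)) \<longleftrightarrow> (\<exists>x. P x)"
proof
  assume "\<exists>x. P x"
  then obtain x where "P x" ..
  moreover obtain m where "x = dec m" using surj_dec by (meson surjD)
  ultimately show "\<exists>m. P (dec m)" by blast
qed blast

text \<open>A single numerical witness loses no generality: by surjectivity of \<open>dec\<close>, a
  number can stand for a pair or a list of witnesses.\<close>

definition semidec :: "('a :: numbered \<Rightarrow> bool) \<Rightarrow> bool" where
  "semidec Q \<longleftrightarrow> (\<exists>R :: 'a \<times> nat \<Rightarrow> bool. computable R \<and> (\<forall>x. Q x \<longleftrightarrow> (\<exists>m. R (x, m))))"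

lemma semidecI:
  fixes R :: "'a :: numbered \<Rightarrow> nat \<Rightarrow> bool"
  assumes "computable (\<lambda>p. R (fst p) (snd p))" "\<And>x. Q x \<longleftrightarrow> (\<exists>m. R x m)"
  shows "semidec Q"
  unfolding semidec_def using assms by (intro exI[of _ "\<lambda>p. R (fst p) (snd p)"]) simp

lemma semidecE:
  assumes "semidec Q"
  obtains R where "\<And>x. Q x \<longleftrightarrow> (\<exists>m. R x m)"
    "computable (\<lambda>p. R (fst p) (snd p :: nat))"
proof -
  obtain R where R: "computable R" "\<And>x. Q x \<longleftrightarrow> (\<exists>m :: nat. R (x, m))"
    using assms unfolding semidec_def by blast
  show ?thesis
    by (rule that[of "\<lambda>x m. R (x, m)"]) (simp_all add: R)
qed

lemma semidec_computable: "computable Q \<Longrightarrow> semidec Q"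
  by (rule semidecI[of "\<lambda>x _. Q x"]) (simp_all add: computable_compose computable_fst computable_id)

lemma semidec_ex:
  fixes Q :: "'a :: numbered \<Rightarrow> 'b :: numbered \<Rightarrow> bool"
  assumes "semidec (\<lambda>p. Q (fst p) (snd p))"
  shows "semidec (\<lambda>x. \<exists>y. Q x y)"
proof -
  obtain R where R: "\<And>p. Q (fst p) (snd p) \<longleftrightarrow> (\<exists>m. R p m)"
    and c: "computable (\<lambda>p. R (fst p) (snd p :: nat))"
    using semidecE[OF assms] by blast
  note c = computable_compose2[OF c]
  define R' where "R' x m = (\<lambda>q. R (x, fst q) (snd q)) (dec m)" for x m
  have "(\<exists>y. Q x y) \<longleftrightarrow> (\<exists>m. R' x m)" for x
  proof -
    have "(\<exists>m. R' x m) \<longleftrightarrow> (\<exists>q. R (x, fst q) (snd q))"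
      unfolding R'_def by (rule ex_dec[where P = "\<lambda>q. R (x, fst q) (snd q)"])
    then show ?thesis using R[of "(x, _)"] by auto
  qed
  then show ?thesis
    by (intro semidecI[of R']) (unfold R'_def, intro c comp_intros, blast)
qed

lemma semidec_conj:
  assumes "semidec Q" "semidec Q'"
  shows "semidec (\<lambda>x. Q x \<and> Q' x)"
proof -
  obtain R where R: "\<And>x. Q x \<longleftrightarrow> (\<exists>m. R x m)"
    and c: "computable (\<lambda>p. R (fst p) (snd p :: nat))"
    using semidecE[OF assms(1)] by blast
  note c = computable_compose2[OF c]
  obtain R' where R': "\<And>x. Q' x \<longleftrightarrow> (\<exists>m. R' x m)"
    and c': "computable (\<lambda>p. R' (fst p) (snd p :: nat))"
    using semidecE[OF assms(2)] by blast
  note c' = computable_compose2[OF c']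
  have "(Q x \<and> Q' x) \<longleftrightarrow> (\<exists>m. (\<lambda>q. R x (fst q) \<and> R' x (snd q)) (dec m))" for x
  proof -
    have "(\<exists>m. (\<lambda>q. R x (fst q) \<and> R' x (snd q)) (dec m)) \<longleftrightarrow> (\<exists>q. R x (fst q) \<and> R' x (snd q))"
      by (rule ex_dec[where P = "\<lambda>q. R x (fst q) \<and> R' x (snd q)"])
    then show ?thesis unfolding R R' by auto
  qed
  then show ?thesis
    by (intro semidecI[of "\<lambda>x m. (\<lambda>q. R x (fst q) \<and> R' x (snd q)) (dec m)"])
      (intro c c' comp_intros, blast)
qed

text \<open>A finite list of witnesses, one for each index, is a single witness.\<close>

lemma semidec_all_less:
  fixes Q :: "'a :: numbered \<Rightarrow> nat \<Rightarrow> bool"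
  assumes "semidec (\<lambda>p. Q (fst p) (snd p))" "computable n"
  shows "semidec (\<lambda>x. \<forall>i < n x. Q x i)"
proof -
  obtain R where R: "\<And>p. Q (fst p) (snd p) \<longleftrightarrow> (\<exists>m. R p m)"
    and c: "computable (\<lambda>p. R (fst p) (snd p :: nat))"
    using semidecE[OF assms(1)] by blast
  note c = computable_compose2[OF c]
  define R' where "R' x m \<longleftrightarrow> (\<forall>i < n x. R (x, i) (nthd 0 (dec m) i))" for x m
  have "(\<forall>i < n x. Q x i) \<longleftrightarrow> (\<exists>m. R' x m)" for x
  proof
    assume "\<forall>i < n x. Q x i"
    then have "\<forall>i < n x. \<exists>m. R (x, i) m" using R[of "(x, _)"] by simp
    then obtain w where w: "\<And>i. i < n x \<Longrightarrow> R (x, i) (w i)" by metis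
    obtain m where m: "map w [0..<n x] = dec m" using surj_dec by (meson surjD)
    have "R' x m" unfolding R'_def m[symmetric] using w by (simp add: nthd_eq)
    then show "\<exists>m. R' x m" ..
  next
    assume "\<exists>m. R' x m"
    then show "\<forall>i < n x. Q x i" using R[of "(x, _)"] by (auto simp: R'_def)
  qed
  then show ?thesis
    by (intro semidecI[of R']) (unfold R'_def, intro c comp_intros computable_compose[OF assms(2)], blast)
qed

text \<open>Post's theorem: search for the first \<open>m\<close> that witnesses one of the two
  predicates, then look which one it is. Complementarity is required only at the given code, because
  it will hold only for codes of valid inputs.\<close>

lemma semidec_decides:
  fixes Q Q' :: "'a :: numbered \<Rightarrow> bool"
  assumes "semidec Q" "semidec Q'"
  shows "\<exists>r. \<forall>c. (Q (dec c) \<longleftrightarrow> \<not> Q' (dec c)) \<longrightarrow> rec_eval r [c] (if Q (dec c) then 1 else 0)"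
proof -
  obtain R where R: "\<And>x. Q x \<longleftrightarrow> (\<exists>m. R x m)"
    and c: "computable (\<lambda>p. R (fst p) (snd p :: nat))"
    using semidecE[OF assms(1)] by blast
  note c = computable_compose2[OF c]
  obtain R' where R': "\<And>x. Q' x \<longleftrightarrow> (\<exists>m. R' x m)"
    and c': "computable (\<lambda>p. R' (fst p) (snd p :: nat))"
    using semidecE[OF assms(2)] by blast
  note c' = computable_compose2[OF c']
  have rec: "\<exists>r. \<forall>m c. rec_eval r [m, c] (if b (dec c) m then u else v)"
    if b: "computable (\<lambda>p :: 'a \<times> nat. b (fst p) (snd p))" for b and u v :: nat
  proof -
    have "computable (\<lambda>p. if b (fst p) (snd p) then u else v)"
      by (intro comp_intros b)
    then obtain K where K: "recursive K" "\<And>c. K c = (\<lambda>p. if b (fst p) (snd p) then u else v) (dec c)"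
      by (auto elim!: computableE simp: dec_nat_def)
    have "recn 2 (\<lambda>ys. K (prod_encode (ys ! 1, ys ! 0)))"
      by (intro recn_recursive[OF K(1)] recn_prod_encode recn_nth) simp_all
    then obtain r where r: "\<And>xs. length xs = 2 \<Longrightarrow> rec_eval r xs (K (prod_encode (xs ! 1, xs ! 0)))"
      unfolding recn_def by blast
    have "rec_eval r [m, c] (if b (dec c) m then u else v)" for m c
      using r[of "[m, c]"] K(2)[of "prod_encode (c, m)"] by (simp add: dec_prod_def dec_nat_def)
    then show ?thesis by blast
  qed
  obtain s where s: "\<And>m c. rec_eval s [m, c] (if R (dec c) m \<or> R' (dec c) m then 0 else 1)"
  proof -
    have "computable (\<lambda>p. R (fst p) (snd p) \<or> R' (fst p) (snd p))" by (intro comp_intros c c')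
    from rec[OF this, of 0 1] show ?thesis using that by blast
  qed
  obtain t where t: "\<And>m c. rec_eval t [m, c] (if R (dec c) m then 1 else 0)"
  proof -
    have "computable (\<lambda>p. R (fst p) (snd p))" by (intro comp_intros c)
    from rec[OF this, of 1 0] show ?thesis using that by blast
  qed
  have "rec_eval (Cnf t [Mnf s, Idf 0]) [c] (if Q (dec c) then 1 else 0)"
    if "Q (dec c) \<longleftrightarrow> \<not> Q' (dec c)" for c
  proof -
    define P where "P m \<longleftrightarrow> R (dec c) m \<or> R' (dec c) m" for m
    define n where "n = (LEAST m. P m)"
    have "\<exists>m. P m" using that R R' unfolding P_def by blast
    then have n: "P n" "\<And>m. m < n \<Longrightarrow> \<not> P m"
      unfolding n_def by (auto intro: LeastI_ex dest: not_less_Least)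
    have "rec_eval (Mnf s) [c] n"
    proof (rule rec_eval.mn)
      show "rec_eval s [n, c] 0" using s[of n c] n(1) unfolding P_def by simp
      show "\<forall>m<n. \<exists>y. rec_eval s [m, c] y \<and> 0 < y"
      proof (intro allI impI)
        fix m assume "m < n"
        from n(2)[OF this] have "rec_eval s [m, c] 1" using s[of m c] unfolding P_def by simp
        then show "\<exists>y. rec_eval s [m, c] y \<and> 0 < y" by force
      qed
    qed
    moreover have "rec_eval (Idf 0) [c] c" using rec_eval.proj[of 0 "[c]"] by simp
    ultimately have "rec_eval (Cnf t [Mnf s, Idf 0]) [c] (if R (dec c) n then 1 else 0)"
      using t[of n c] by (intro rec_eval.comp[where ys = "[n, c]"]) simp_all
    moreover have "R (dec c) n \<longleftrightarrow> Q (dec c)" using n(1) that R R' unfolding P_def by blast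
    ultimately show ?thesis by simp
  qed
  then show ?thesis by blast
qed

section \<open>Special product rules\<close>

definition mon_eval :: "(nat \<Rightarrow> rat) \<Rightarrow> (nat \<Rightarrow>\<^sub>0 nat) \<Rightarrow> rat" where
  "mon_eval \<rho> m = (\<Prod>x \<in> Poly_Mapping.keys m. \<rho> x ^ Poly_Mapping.lookup m x)"

text \<open>Evaluation is a ring homomorphism agreeing with \<open>evalF\<close> on denotations. It
  turns the axioms of \<open>special\<close>, stated with \<open>\<approx>\<close>, into identities
  between rational numbers.\<close>

definition mpoly_eval :: "(nat \<Rightarrow> rat) \<Rightarrow> mpoly \<Rightarrow> rat" where
  "mpoly_eval \<rho> p = (\<Sum>m \<in> Poly_Mapping.keys p. Poly_Mapping.lookup p m * mon_eval \<rho> m)"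

lemma mon_eval_superset:
  assumes "finite A" "Poly_Mapping.keys m \<subseteq> A"
  shows "mon_eval \<rho> m = (\<Prod>x \<in> A. \<rho> x ^ Poly_Mapping.lookup m x)"
  unfolding mon_eval_def
  by (rule prod.mono_neutral_left) (use assms in \<open>auto simp: in_keys_iff\<close>)

lemma mon_eval_add: "mon_eval \<rho> (m + n) = mon_eval \<rho> m * mon_eval \<rho> n"
proof -
  define A where "A = Poly_Mapping.keys m \<union> Poly_Mapping.keys n"
  have "finite A" "Poly_Mapping.keys m \<subseteq> A" "Poly_Mapping.keys n \<subseteq> A" "Poly_Mapping.keys (m + n) \<subseteq> A"
    using keys_add[of m n] by (auto simp: A_def)
  then show ?thesis
    by (simp add: mon_eval_superset[of A] lookup_add power_add prod.distrib)
qed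

lemma mpoly_eval_add: "mpoly_eval \<rho> (p + q) = mpoly_eval \<rho> p + mpoly_eval \<rho> q"
  unfolding mpoly_eval_def by (rule setsum_keys_plus_distrib) (simp_all add: distrib_right)

lemma mpoly_eval_single: "mpoly_eval \<rho> (Poly_Mapping.single m c) = c * mon_eval \<rho> m"
  by (simp add: mpoly_eval_def)

lemma mpoly_eval_sum: "mpoly_eval \<rho> (sum f A) = (\<Sum>i \<in> A. mpoly_eval \<rho> (f i))"
proof (induction A rule: infinite_finite_induct)
  case (insert x F)
  then show ?case by (simp add: mpoly_eval_add)
qed (simp_all add: mpoly_eval_def)

lemma mpoly_sum_monomials:
  "(\<Sum>m \<in> Poly_Mapping.keys p. Poly_Mapping.single m (Poly_Mapping.lookup p m)) = (p :: mpoly)"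
proof (rule poly_mapping_eqI)
  fix k
  have "Poly_Mapping.lookup (\<Sum>m \<in> Poly_Mapping.keys p. Poly_Mapping.single m (Poly_Mapping.lookup p m)) k
      = (\<Sum>m \<in> Poly_Mapping.keys p. if m = k then Poly_Mapping.lookup p m else 0)"
    unfolding lookup_sum lookup_single by (intro sum.cong) (auto simp: when_def)
  also have "\<dots> = Poly_Mapping.lookup p k"
    by (auto simp: in_keys_iff)
  finally show "Poly_Mapping.lookup (\<Sum>m \<in> Poly_Mapping.keys p. Poly_Mapping.single m (Poly_Mapping.lookup p m)) k
    = Poly_Mapping.lookup p k" .
qed

lemma mpoly_eval_mult: "mpoly_eval \<rho> (p * q) = mpoly_eval \<rho> p * mpoly_eval \<rho> q"
proof -
  have "p * q = (\<Sum>m \<in> Poly_Mapping.keys p. Poly_Mapping.single m (Poly_Mapping.lookup p m)) *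
      (\<Sum>n \<in> Poly_Mapping.keys q. Poly_Mapping.single n (Poly_Mapping.lookup q n))"
    by (simp only: mpoly_sum_monomials)
  also have "\<dots> = (\<Sum>m \<in> Poly_Mapping.keys p. \<Sum>n \<in> Poly_Mapping.keys q.
      Poly_Mapping.single (m + n) (Poly_Mapping.lookup p m * Poly_Mapping.lookup q n))"
    by (simp add: sum_product mult_single)
  finally have "mpoly_eval \<rho> (p * q) = (\<Sum>m \<in> Poly_Mapping.keys p. \<Sum>n \<in> Poly_Mapping.keys q.
      Poly_Mapping.lookup p m * Poly_Mapping.lookup q n * mon_eval \<rho> (m + n))"
    by (simp add: mpoly_eval_sum mpoly_eval_single)
  then show ?thesis
    by (simp add: mpoly_eval_def sum_product mon_eval_add algebra_simps)
qed

lemma mpoly_eval_denot: "mpoly_eval \<rho> (denot t) = evalF \<rho> t"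
  by (induction t)
    (simp_all add: mpoly_eval_single mpoly_eval_mult mpoly_eval_add, simp_all add: mon_eval_def mpoly_eval_def)

lemma evalF_cong_peq: "s \<approx> t \<Longrightarrow> evalF \<rho> s = evalF \<rho> t"
  by (metis mpoly_eval_denot peq_def)

lemma evalF_subst: "evalF \<rho> (subst \<sigma> t) = evalF (\<lambda>x. evalF \<rho> (\<sigma> x)) t"
  by (induction t) simp_all

lemma evalF_cong: "(\<And>x. x \<in> vars t \<Longrightarrow> \<rho> x = \<rho>' x) \<Longrightarrow> evalF \<rho> t = evalF \<rho>' t"
  by (induction t) auto

definition env4 :: "rat \<Rightarrow> rat \<Rightarrow> rat \<Rightarrow> rat \<Rightarrow> nat \<Rightarrow> rat" where
  "env4 x x' y y' = (\<lambda>i. if i = 0 then x else if i = 1 then x' else if i = 2 then y else y')"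

lemma evalF_app4_env4:
  assumes "product_rule P"
  shows "evalF \<rho> (app4 P s1 s2 s3 s4) = evalF (env4 (evalF \<rho> s1) (evalF \<rho> s2) (evalF \<rho> s3) (evalF \<rho> s4)) P"
  unfolding app4_def evalF_subst
  by (rule evalF_cong) (use assms in \<open>auto simp: product_rule_def env4_def\<close>)

text \<open>Cauchy's functional equation over the rationals: additivity gives compatibility with
  integer factors, and clearing the denominator of \<open>x\<close> gives the rest.\<close>

lemma additive_rat_linear:
  fixes g :: "rat \<Rightarrow> rat"
  assumes add: "\<And>x y. g (x + y) = g x + g y"
  shows "g x = x * g 1"
proof -
  have g0: "g 0 = 0" using add[of 0 0] by simp
  have nat: "g (of_nat n * y) = of_nat n * g y" for n y
    by (induction n) (simp_all add: g0 add algebra_simps)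
  have neg: "g (- y) = - g y" for y using add[of y "- y"] g0 by simp
  have int: "g (of_int k * y) = of_int k * g y" for k y
  proof (cases k)
    case (nonneg n)
    then show ?thesis using nat by simp
  next
    case (neg n)
    then show ?thesis using nat[of "Suc n" y] \<open>\<And>y. g (- y) = - g y\<close>[of "of_nat (Suc n) * y"]
      by (simp add: algebra_simps del: of_nat_Suc)
  qed
  obtain a b where ab: "x = of_int a / of_int b" "b > 0"
    by (metis Rat_cases Fract_of_int_quotient)
  have "of_int b * g x = g (of_int a * 1)" using int[of b x] ab by simp
  also have "\<dots> = of_int a * g 1" by (rule int)
  finally have "of_int b * g x = of_int b * (x * g 1)" using ab by simp
  then show ?thesis using ab(2) by simp
qed

locale bilinear_rule =
  fixes P :: trm and \<alpha> \<beta> \<gamma> :: rat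
  assumes evalF_app4: "evalF \<rho> (app4 P s1 s2 s3 s4) =
      \<alpha> * evalF \<rho> s1 * evalF \<rho> s3 + \<beta> * (evalF \<rho> s1 * evalF \<rho> s4 + evalF \<rho> s2 * evalF \<rho> s3)
        + \<gamma> * evalF \<rho> s2 * evalF \<rho> s4"
    and assoc_coeff: "\<beta> * \<beta> = \<alpha> * \<gamma> + \<beta>"

text \<open>Additivity in the pair (x, x') is linearity over the rationals, and symmetry carries it
  to (y, y'). The form is then determined by its values on the pairs (1, 0) and (0, 1).\<close>

lemma special_bilinear:
  assumes "product_rule P" "special P"
  obtains \<alpha> \<beta> \<gamma> where "bilinear_rule P \<alpha> \<beta> \<gamma>"
proof -
  define p where "p x x' y y' = evalF (env4 x x' y y') P" for x x' y y'
  have ev: "evalF \<rho> (app4 P s1 s2 s3 s4) = p (evalF \<rho> s1) (evalF \<rho> s2) (evalF \<rho> s3) (evalF \<rho> s4)"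
    for \<rho> s1 s2 s3 s4
    unfolding p_def by (rule evalF_app4_env4[OF assms(1)])
  define r where "r x x' y y' z z' = (\<lambda>i :: nat. if i = 0 then x else if i = 1 then x' else if i = 2 then y
      else if i = 3 then y' else if i = 4 then z else (z' :: rat))" for x x' y y' z z'
  note sp = assms(2)[unfolded special_def Let_def]
  have add1: "p (x + y) (x' + y') z z' = p x x' z z' + p y y' z z'" for x x' y y' z z'
    using evalF_cong_peq[OF conjunct1[OF sp], of "r x x' y y' z z'"] by (simp add: ev r_def)
  have assoc: "p x x' (y * z) (p y y' z z') = p (x * y) (p x x' y y') z z'" for x x' y y' z z'
    using evalF_cong_peq[OF conjunct1[OF conjunct2[OF sp]], of "r x x' y y' z z'"] by (simp add: ev r_def)
  have sym: "p x x' y y' = p y y' x x'" for x x' y y'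
    using evalF_cong_peq[OF conjunct2[OF conjunct2[OF sp]], of "r x x' y y' 0 0"] by (simp add: ev r_def)
  have lin1: "p (c * x) (c * x') z z' = c * p x x' z z'" for c x x' z z'
    using additive_rat_linear[of "\<lambda>c. p (c * x) (c * x') z z'" c] by (simp add: distrib_right add1)
  have split1: "p x x' z z' = x * p 1 0 z z' + x' * p 0 1 z z'" for x x' z z'
    using add1[of x 0 0 x' z z'] lin1[of x 1 0 z z'] lin1[of x' 0 1 z z'] by simp
  define \<alpha> \<beta> \<gamma> where "\<alpha> = p 1 0 1 0" and "\<beta> = p 1 0 0 1" and "\<gamma> = p 0 1 0 1"
  have form: "p x x' y y' = \<alpha> * x * y + \<beta> * (x * y' + x' * y) + \<gamma> * x' * y'" for x x' y y'
    using split1[of x x' y y'] sym[of 1 0 y y'] sym[of 0 1 y y'] split1[of y y' 1 0] split1[of y y' 0 1]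
      sym[of 0 1 1 0]
    by (simp add: \<alpha>_def \<beta>_def \<gamma>_def algebra_simps)
  \<comment> \<open>Associativity at (x, x') = (0, 1) and (y, y') = (z, z') = (1, 0): the left side
    is \<open>\<beta> + \<alpha> * \<gamma>\<close>, the right side
    \<open>\<beta> * \<beta>\<close>.\<close>
  have "\<beta> * \<beta> = \<alpha> * \<gamma> + \<beta>"
    using assoc[of 0 1 1 1 0 0] unfolding form by (simp add: algebra_simps)
  then have "bilinear_rule P \<alpha> \<beta> \<gamma>"
    by (intro bilinear_rule.intro) (simp only: ev form)
  then show ?thesis by (rule that)
qed

text \<open>Pointwise equality, implied by \<open>\<approx>\<close>, replaces it from here on:
  polynomials become functions, with pointwise ring operations.\<close>

definition feq :: "trm \<Rightarrow> trm \<Rightarrow> bool" where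
  "feq s t \<longleftrightarrow> (\<forall>\<rho>. evalF \<rho> s = evalF \<rho> t)"

text \<open>Serves twice: linear polynomials as values give calculations modulo the square of the
  indeterminate, and a polynomial in one coordinate with constants in the others gives the
  restriction to a line.\<close>

fun eval_poly :: "(nat \<Rightarrow> rat poly) \<Rightarrow> trm \<Rightarrow> rat poly" where
  "eval_poly \<sigma> (Var x) = \<sigma> x"
| "eval_poly \<sigma> Zero = 0"
| "eval_poly \<sigma> (Scal c t) = smult c (eval_poly \<sigma> t)"
| "eval_poly \<sigma> (Plus s t) = eval_poly \<sigma> s + eval_poly \<sigma> t"
| "eval_poly \<sigma> (Times s t) = eval_poly \<sigma> s * eval_poly \<sigma> t"

lemma poly_eval_poly: "poly (eval_poly \<sigma> t) x = evalF (\<lambda>i. poly (\<sigma> i) x) t"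
  by (induction t) simp_all

lemma eval_poly_feq: "feq s t \<Longrightarrow> eval_poly \<sigma> s = eval_poly \<sigma> t"
  by (rule poly_eq_poly_eq_iff[THEN iffD1]) (simp add: fun_eq_iff poly_eval_poly feq_def)

context bilinear_rule
begin

text \<open>At a point \<open>\<rho>\<close>, the pair \<open>(t, pext P D t)\<close> is the value of \<open>t\<close> in a two-dimensional commutative
  algebra of pairs \<open>(a, a')\<close>.  If \<open>\<gamma> \<noteq> 0\<close>, then \<open>\<gamma>a' + \<beta>a\<close> is multiplicative; otherwise
  \<open>\<beta>a + (a' - \<kappa>a)\<epsilon>\<close> is multiplicative modulo \<open>\<epsilon>\<^sup>2\<close> for a suitable \<open>\<kappa>\<close>.  Either way, \<open>pext P D t\<close> depends
  only on the polynomial function of \<open>t\<close>.\<close>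

lemma pext_point:
  assumes "\<gamma> \<noteq> 0"
  shows "\<gamma> * evalF \<rho> (pext P D t) + \<beta> * evalF \<rho> t = evalF (\<lambda>x. \<gamma> * evalF \<rho> (D x) + \<beta> * \<rho> x) t"
proof (induction t)
  case (Times s t)
  have "(\<gamma> * a' + \<beta> * a) * (\<gamma> * b' + \<beta> * b) =
      \<gamma> * (\<alpha> * a * b + \<beta> * (a * b' + a' * b) + \<gamma> * a' * b') + \<beta> * (a * b)" for a a' b b'
  proof -
    have "(\<gamma> * a' + \<beta> * a) * (\<gamma> * b' + \<beta> * b) =
        \<gamma> * \<gamma> * a' * b' + \<gamma> * \<beta> * (a * b' + a' * b) + (\<beta> * \<beta>) * a * b" by (simp add: algebra_simps)
    then show ?thesis by (simp add: assoc_coeff algebra_simps)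
  qed
  then show ?case by (simp add: evalF_app4 Times[symmetric])
next
  case (Scal c t)
  show ?case by (simp add: Scal[symmetric]) (simp add: algebra_simps)
qed (simp_all add: algebra_simps)

lemma pext_derivation:
  fixes D :: "nat \<Rightarrow> trm"
  assumes "\<gamma> = 0" and \<kappa>: "\<kappa> = \<alpha> + 2 * \<beta> * \<kappa>"
  defines "\<sigma> \<equiv> \<lambda>\<rho> x. [:\<beta> * \<rho> x, evalF \<rho> (D x) - \<kappa> * \<rho> x:]"
  shows "coeff (eval_poly (\<sigma> \<rho>) t) 0 = \<beta> * evalF \<rho> t \<and>
    evalF \<rho> (pext P D t) = \<kappa> * evalF \<rho> t + coeff (eval_poly (\<sigma> \<rho>) t) 1"
proof (induction t)
  case (Times s t)
  have beta: "\<beta> * \<beta> = \<beta>" using assoc_coeff assms(1) by simp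
  define a b a' b' where "a = evalF \<rho> s" and "b = evalF \<rho> t"
    and "a' = coeff (eval_poly (\<sigma> \<rho>) s) 1" and "b' = coeff (eval_poly (\<sigma> \<rho>) t) 1"
  have c0: "coeff (eval_poly (\<sigma> \<rho>) (Times s t)) 0 = \<beta> * (a * b)"
    using Times beta by (cases "\<beta> = 0") (simp_all add: coeff_mult a_def b_def)
  have c1: "coeff (eval_poly (\<sigma> \<rho>) (Times s t)) 1 = \<beta> * (a * b' + a' * b)"
    using Times by (simp add: coeff_mult a_def b_def a'_def b'_def algebra_simps)
  have "evalF \<rho> (pext P D (Times s t)) = \<alpha> * a * b + \<beta> * (a * (\<kappa> * b + b') + (\<kappa> * a + a') * b)"
    using Times by (simp add: evalF_app4 assms(1) a_def b_def a'_def b'_def)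
  also have "\<dots> = (\<alpha> + 2 * \<beta> * \<kappa>) * (a * b) + \<beta> * (a * b' + a' * b)" by (simp add: algebra_simps)
  also have "\<dots> = \<kappa> * (a * b) + \<beta> * (a * b' + a' * b)" using \<kappa> by simp
  finally show ?case using c0 c1 by (simp add: a_def b_def)
qed (simp_all add: \<sigma>_def algebra_simps)

lemma pext_feq:
  assumes "feq s t"
  shows "feq (pext P D s) (pext P D t)"
proof (cases "\<gamma> = 0")
  case False
  show ?thesis
    unfolding feq_def
  proof
    fix \<rho>
    have "\<gamma> * evalF \<rho> (pext P D s) = \<gamma> * evalF \<rho> (pext P D t)"
      using pext_point[OF False, of \<rho> D s] pext_point[OF False, of \<rho> D t] assms
      unfolding feq_def by (metis add_right_cancel)
    then show "evalF \<rho> (pext P D s) = evalF \<rho> (pext P D t)" using False by simp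
  qed
next
  case True
  then have "\<beta> = 0 \<or> \<beta> = 1" using assoc_coeff by auto
  \<comment> \<open>The equation says that subtracting \<open>\<kappa>\<close> times the value
    cancels the summand with \<open>\<alpha>\<close> in the product rule. Its solution is
    \<open>\<alpha>\<close> for \<open>\<beta> = 0\<close> and \<open>- \<alpha>\<close> for
    \<open>\<beta> = 1\<close>.\<close>
  then have \<kappa>: "\<exists>\<kappa>. \<kappa> = \<alpha> + 2 * \<beta> * \<kappa>"
    by (elim disjE) (auto intro: exI[of _ "- \<alpha>"])
  then obtain \<kappa> where "\<kappa> = \<alpha> + 2 * \<beta> * \<kappa>" ..
  from pext_derivation[OF True this] show ?thesis
    using assms eval_poly_feq[OF assms] by (simp add: feq_def)
qed

end

section \<open>Hilbert's basis theorem\<close>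

text \<open>Linear combinations of \<open>S\<close> with coefficients in \<open>A\<close>. Rings are
  subsets of a type because the number of variables, which varies with the input, cannot be part of
  a type.\<close>

inductive_set idl :: "'r :: comm_ring_1 set \<Rightarrow> 'r set \<Rightarrow> 'r set" for A S where
  zero: "0 \<in> idl A S"
| step: "a \<in> A \<Longrightarrow> g \<in> S \<Longrightarrow> h \<in> idl A S \<Longrightarrow> a * g + h \<in> idl A S"

definition subring :: "'r :: comm_ring_1 set \<Rightarrow> bool" where
  "subring A \<longleftrightarrow> 1 \<in> A \<and> - 1 \<in> A \<and> (\<forall>a\<in>A. \<forall>b\<in>A. a + b \<in> A \<and> a * b \<in> A)"

text \<open>The finite generating set is taken inside \<open>S\<close> itself. This later yields
  generators that are reachable terms, on which the output function is known to vanish.\<close>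

definition noetherian :: "'r :: comm_ring_1 set \<Rightarrow> bool" where
  "noetherian A \<longleftrightarrow> (\<forall>S. S \<subseteq> A \<longrightarrow> (\<exists>T. T \<subseteq> S \<and> finite T \<and> S \<subseteq> idl A T))"

lemma noetherianD:
  "noetherian A \<Longrightarrow> S \<subseteq> A \<Longrightarrow> \<exists>T. T \<subseteq> S \<and> finite T \<and> S \<subseteq> idl A T"
  unfolding noetherian_def by (drule spec) (erule mp)

lemma subringD:
  assumes "subring A"
  shows "1 \<in> A" "- 1 \<in> A" "0 \<in> A" "a \<in> A \<Longrightarrow> b \<in> A \<Longrightarrow> a + b \<in> A"
    "a \<in> A \<Longrightarrow> b \<in> A \<Longrightarrow> a * b \<in> A"
proof -
  show "1 \<in> A" "- 1 \<in> A" "a \<in> A \<Longrightarrow> b \<in> A \<Longrightarrow> a + b \<in> A" "a \<in> A \<Longrightarrow> b \<in> A \<Longrightarrow> a * b \<in> A"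
    using assms by (auto simp: subring_def)
  have "1 + - 1 \<in> A" using assms unfolding subring_def by blast
  then show "0 \<in> A" by simp
qed

lemma subring_sum: "subring A \<Longrightarrow> (\<And>i. i \<in> I \<Longrightarrow> f i \<in> A) \<Longrightarrow> sum f I \<in> A"
  by (induction I rule: infinite_finite_induct) (auto intro: subringD)

lemma idl_mono: "x \<in> idl A S \<Longrightarrow> A \<subseteq> B \<Longrightarrow> S \<subseteq> T \<Longrightarrow> x \<in> idl B T"
  by (induction rule: idl.induct) (auto intro: idl.intros)

lemma idl_add: "x \<in> idl A S \<Longrightarrow> y \<in> idl A S \<Longrightarrow> x + y \<in> idl A S"
  by (induction rule: idl.induct) (auto intro: idl.step simp: add.assoc)

lemma idl_mult: "x \<in> idl A S \<Longrightarrow> subring A \<Longrightarrow> a \<in> A \<Longrightarrow> a * x \<in> idl A S"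
proof (induction rule: idl.induct)
  case zero
  show ?case by (simp add: idl.zero)
next
  case (step b g h)
  then have "(a * b) * g + a * h \<in> idl A S" by (intro idl.step) (auto intro: subringD(5))
  then show ?case by (simp add: algebra_simps)
qed

lemma idl_diff: "x \<in> idl A S \<Longrightarrow> y \<in> idl A S \<Longrightarrow> subring A \<Longrightarrow> x - y \<in> idl A S"
  using idl_add[of x A S "- 1 * y"] idl_mult[of y A S "- 1"] subringD(2) by fastforce

lemma idl_base: "subring A \<Longrightarrow> g \<in> S \<Longrightarrow> g \<in> idl A S"
  using idl.step[of 1 A g S 0] by (simp add: idl.zero subringD(1))

lemma idl_trans: "x \<in> idl A S \<Longrightarrow> subring A \<Longrightarrow> S \<subseteq> idl A T \<Longrightarrow> x \<in> idl A T"
  by (induction rule: idl.induct) (auto intro: idl.zero idl_add idl_mult)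

lemma idl_subset: "x \<in> idl A S \<Longrightarrow> subring A \<Longrightarrow> S \<subseteq> A \<Longrightarrow> x \<in> A"
  by (induction rule: idl.induct) (auto intro: subringD)

lemma idl_finite_support: "x \<in> idl A S \<Longrightarrow> \<exists>T. T \<subseteq> S \<and> finite T \<and> x \<in> idl A T"
proof (induction rule: idl.induct)
  case zero
  show ?case by (auto intro: idl.zero)
next
  case (step a g h)
  then obtain T where T: "T \<subseteq> S" "finite T" "h \<in> idl A T" by blast
  have "a * g + h \<in> idl A (insert g T)"
    using step T(3) by (intro idl.step) (auto elim: idl_mono)
  then show ?case using step T by (intro exI[of _ "insert g T"]) auto
qed

lemma noetherian_image:
  assumes "noetherian A" "\<phi> 0 = 0" "\<And>a b. \<phi> (a + b) = \<phi> a + \<phi> b" "\<And>a b. \<phi> (a * b) = \<phi> a * \<phi> b"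
  shows "noetherian (\<phi> ` A)"
  unfolding noetherian_def
proof (intro allI impI)
  fix S assume S: "S \<subseteq> \<phi> ` A"
  define S' where "S' = {a \<in> A. \<phi> a \<in> S}"
  have im: "\<phi> x \<in> idl (\<phi> ` A) (\<phi> ` T)" if "x \<in> idl A T" for x T
    using that by (induction rule: idl.induct) (auto simp: assms intro: idl.intros)
  obtain T where T: "T \<subseteq> S'" "finite T" "S' \<subseteq> idl A T"
    using noetherianD[OF assms(1), of S'] by (auto simp: S'_def)
  have "S \<subseteq> idl (\<phi> ` A) (\<phi> ` T)"
  proof
    fix s assume "s \<in> S"
    then obtain a where "a \<in> A" "s = \<phi> a" using S by blast
    then have "a \<in> S'" using \<open>s \<in> S\<close> by (simp add: S'_def)
    then show "s \<in> idl (\<phi> ` A) (\<phi> ` T)" using im T(3) \<open>s = \<phi> a\<close> by blast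
  qed
  moreover have "\<phi> ` T \<subseteq> S" using T(1) by (auto simp: S'_def)
  ultimately show "\<exists>T. T \<subseteq> S \<and> finite T \<and> S \<subseteq> idl (\<phi> ` A) T"
    using T(2) by blast
qed

definition polys_over :: "'r :: comm_ring_1 set \<Rightarrow> 'r poly set" where
  "polys_over A = {p. \<forall>i. coeff p i \<in> A}"

lemma subring_polys_over:
  assumes "subring A"
  shows "subring (polys_over A)"
  unfolding subring_def
proof (intro conjI ballI)
  show "1 \<in> polys_over A" "- 1 \<in> polys_over A"
    using subringD[OF assms] by (auto simp: polys_over_def coeff_1 if_distrib)
  fix p q assume "p \<in> polys_over A" "q \<in> polys_over A"
  then show "p + q \<in> polys_over A" "p * q \<in> polys_over A"
    using subringD[OF assms] by (auto simp: polys_over_def coeff_mult intro!: subring_sum[OF assms])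
qed

lemma monom_polys_over: "subring A \<Longrightarrow> a \<in> A \<Longrightarrow> monom a n \<in> polys_over A"
  by (auto simp: polys_over_def subringD(3))

text \<open>The classical argument: if an ideal is not finitely generated, repeatedly pick an
  element of least degree outside the ideal of the earlier ones, and use noetherianity of
  \<open>A\<close> for the leading coefficients.\<close>

theorem hilbert_basis:
  fixes A :: "'r :: comm_ring_1 set"
  assumes A: "subring A" and noeth: "noetherian A"
  shows "noetherian (polys_over A)"
proof (rule ccontr)
  define B where "B = polys_over A"
  have B: "subring B" unfolding B_def by (rule subring_polys_over[OF A])
  assume "\<not> noetherian (polys_over A)"
  then have "\<exists>S. S \<subseteq> B \<and> \<not> (\<exists>T. T \<subseteq> S \<and> finite T \<and> S \<subseteq> idl B T)"
    by (simp add: noetherian_def B_def)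
  then obtain S where S1: "S \<subseteq> B" and S2: "\<not> (\<exists>T. T \<subseteq> S \<and> finite T \<and> S \<subseteq> idl B T)"
    by (elim exE conjE)
  have S: "S \<subseteq> B" "\<not> S \<subseteq> idl B T" if "T \<subseteq> S" "finite T" for T
    using S1 S2 that by simp_all
  define I where "I = idl B S"
  have IB: "I \<subseteq> B" unfolding I_def using idl_subset[OF _ B S1] by blast
  \<comment> \<open>Passing from subsets of \<open>S\<close> to subsets of \<open>I\<close> is
    harmless: each element of \<open>I\<close> is a combination of finitely many elements of
    \<open>S\<close>.\<close>
  have not_fg: "\<exists>g. g \<in> I - idl B T" if T: "finite T" "T \<subseteq> I" for T
  proof (rule ccontr)
    assume "\<nexists>g. g \<in> I - idl B T"
    then have *: "I \<subseteq> idl B T" by blast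
    have "\<exists>U. U \<subseteq> S \<and> finite U \<and> t \<in> idl B U" if "t \<in> T" for t
      using idl_finite_support that T(2) unfolding I_def by blast
    then obtain U where U: "\<And>t. t \<in> T \<Longrightarrow> U t \<subseteq> S \<and> finite (U t) \<and> t \<in> idl B (U t)" by metis
    have "T \<subseteq> idl B (\<Union>t\<in>T. U t)" using U by (blast intro: idl_mono)
    then have "S \<subseteq> idl B (\<Union>t\<in>T. U t)"
      using * idl_base[OF B] idl_trans[OF _ B] unfolding I_def by blast
    then show False using S(2)[of "\<Union>t\<in>T. U t"] U T(1) by blast
  qed
  define pick where "pick T = (ARG_MIN degree g. g \<in> I - idl B T)" for T
  have pick: "pick T \<in> I - idl B T" "\<And>g. g \<in> I - idl B T \<Longrightarrow> degree (pick T) \<le> degree g"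
    if T: "finite T" "T \<subseteq> I" for T
  proof -
    obtain g where g: "g \<in> I - idl B T" using not_fg[OF T] by blast
    show "pick T \<in> I - idl B T"
      unfolding pick_def by (rule arg_min_natI[where P = "\<lambda>g. g \<in> I - idl B T", OF g])
    show "degree (pick T) \<le> degree g" if "g \<in> I - idl B T" for g
      unfolding pick_def by (rule arg_min_nat_le[where P = "\<lambda>g. g \<in> I - idl B T", OF that])
  qed
  define Ts where "Ts = rec_nat {} (\<lambda>_ T. insert (pick T) T)"
  define f where "f n = pick (Ts n)" for n
  have Ts_eq: "Ts n = f ` {..<n}" for n
    by (induction n) (simp_all add: Ts_def f_def lessThan_Suc)
  have Ts: "finite (Ts n)" "Ts n \<subseteq> I" for n
  proof -
    show "finite (Ts n)" by (simp add: Ts_eq)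
    show "Ts n \<subseteq> I"
    proof (induction n)
      case (Suc n)
      then show ?case using pick(1)[of "Ts n"] Ts_eq[of n] by (simp add: Ts_def)
    qed (simp add: Ts_def)
  qed
  have f: "f n \<in> I" "f n \<notin> idl B (Ts n)" "\<And>g. g \<in> I \<Longrightarrow> g \<notin> idl B (Ts n) \<Longrightarrow> degree (f n) \<le> degree g" for n
    using pick[OF Ts] unfolding f_def by auto
  have deg_mono: "degree (f k) \<le> degree (f m)" if "k \<le> m" for k m
  proof (rule f(3)[OF f(1)])
    have "Ts k \<subseteq> Ts m" using that by (auto simp: Ts_eq)
    then show "f m \<notin> idl B (Ts k)" using f(2)[of m] idl_mono by blast
  qed
  define a where "a n = lead_coeff (f n)" for n
  have "range a \<subseteq> A" using f(1) IB by (auto simp: a_def B_def polys_over_def)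
  from noetherianD[OF noeth this]
  obtain T0 where T0: "T0 \<subseteq> range a" "finite T0" "range a \<subseteq> idl A T0"
    by (elim exE conjE)
  obtain J where J: "finite J" "T0 = a ` J" using finite_subset_image[OF T0(2,1)] by blast
  obtain m where m: "J \<subseteq> {..<m}" using finite_nat_bounded[OF J(1)] by blast
  define N where "N = degree (f m)"
  \<comment> \<open>Degrees of the picked elements increase weakly, so multiplying by powers of the
    indeterminate brings all earlier ones to degree \<open>N\<close>; combinations of leading
    coefficients become combinations of polynomials.\<close>
  have lift: "\<exists>g. g \<in> idl B (Ts m) \<and> degree g \<le> N \<and> coeff g N = b" if "b \<in> idl A (a ` {..<m})" for b
    using that
  proof (induction rule: idl.induct)
    case zero
    show ?case by (intro exI[of _ 0]) (simp add: idl.zero)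
  next
    case (step c x h)
    then obtain g where g: "g \<in> idl B (Ts m)" "degree g \<le> N" "coeff g N = h" by blast
    obtain k where k: "k < m" "x = a k" using step by blast
    define n where "n = N - degree (f k)"
    have n: "n + degree (f k) = N" using deg_mono[of k m] k by (simp add: n_def N_def)
    have "monom c n * f k + g \<in> idl B (Ts m)"
      using step g k by (intro idl.step) (auto simp: B_def Ts_eq intro: monom_polys_over[OF A])
    moreover have "degree (monom c n * f k) \<le> N"
      using degree_mult_le[of "monom c n" "f k"] degree_monom_le[of c n] n by linarith
    then have "degree (monom c n * f k + g) \<le> N" using g by (intro degree_add_le)
    moreover have "coeff (monom c n * f k + g) N = c * x + h"
      using n g(3) by (auto simp: coeff_monom_mult k a_def)
    ultimately show ?case by blast
  qed
  have "a m \<in> idl A T0" using T0(3) by (rule subsetD) (rule rangeI)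
  then have "a m \<in> idl A (a ` {..<m})" by (rule idl_mono) (use J(2) m in auto)
  then obtain g where g: "g \<in> idl B (Ts m)" "degree g \<le> N" "coeff g N = a m" using lift by blast
  \<comment> \<open>The leading terms cancel. As \<open>d\<close> is in \<open>I\<close> but outside
    the ideal of the earlier elements, a degree below \<open>N\<close> contradicts the minimal
    choice of \<open>f m\<close>.\<close>
  define d where "d = f m - g"
  have "d \<notin> idl B (Ts m)" using f(2)[of m] idl_add[OF g(1), of d] by (auto simp: d_def)
  moreover have "d \<in> I"
    unfolding d_def I_def
    using f(1) g(1) Ts(2) idl_trans[OF g(1) B] unfolding I_def by (intro idl_diff B) auto
  ultimately have "N \<le> degree d" using f(3) by (simp add: N_def)
  moreover have "degree d \<le> N" unfolding d_def using g(2) by (intro degree_diff_le) (simp_all add: N_def)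
  moreover have "coeff d N = 0" using g(3) by (simp add: d_def N_def a_def)
  ultimately have "d = 0" by (metis antisym leading_coeff_0_iff)
  then show False using \<open>d \<notin> idl B (Ts m)\<close> by (simp add: idl.zero)
qed

text \<open>The ring A[x] as an image of the polynomial ring under evaluation. As a homomorphic
  image it inherits noetherianity, whether or not \<open>x\<close> is transcendental over
  \<open>A\<close>.\<close>

definition adjoin :: "'r :: comm_ring_1 set \<Rightarrow> 'r \<Rightarrow> 'r set" where
  "adjoin A x = (\<lambda>p. poly p x) ` polys_over A"

lemma noetherian_adjoin: "subring A \<Longrightarrow> noetherian A \<Longrightarrow> noetherian (adjoin A x)"
  unfolding adjoin_def by (intro noetherian_image hilbert_basis) simp_all

lemma subring_adjoin:
  assumes "subring A"
  shows "subring (adjoin A x)"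
proof -
  note P = subringD[OF subring_polys_over[OF assms]]
  have "poly 1 x \<in> adjoin A x" "poly (- 1) x \<in> adjoin A x"
    unfolding adjoin_def using P by blast+
  moreover have "poly p x + poly q x \<in> adjoin A x" "poly p x * poly q x \<in> adjoin A x"
    if "p \<in> polys_over A" "q \<in> polys_over A" for p q
    unfolding adjoin_def poly_add[symmetric] poly_mult[symmetric] using P that by blast+
  ultimately show ?thesis by (auto simp: subring_def adjoin_def)
qed

lemma adjoin_superset: "subring A \<Longrightarrow> a \<in> A \<Longrightarrow> a \<in> adjoin A x"
  using monom_polys_over[of A a 0] unfolding adjoin_def by (force simp: poly_monom)

lemma adjoin_self: "subring A \<Longrightarrow> x \<in> adjoin A x"
  using monom_polys_over[of A 1 1] subringD(1) unfolding adjoin_def by (force simp: poly_monom)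

lemma adjoin_subset:
  assumes "subring B" "A \<subseteq> B" "x \<in> B"
  shows "adjoin A x \<subseteq> B"
proof -
  have pow: "x ^ i \<in> B" for i by (induction i) (auto intro: subringD[OF assms(1)] assms)
  show ?thesis
    unfolding adjoin_def polys_over_def
    using assms pow by (auto simp: poly_altdef intro!: subring_sum subringD(5))
qed

section \<open>Rings of polynomial functions\<close>

type_synonym polyfun = "(nat \<Rightarrow> rat) \<Rightarrow> rat"

text \<open>The polynomials in the first \<open>n\<close> variables, seen as functions of an
  assignment to all variables, so that the type is the same for every \<open>n\<close>.\<close>

primrec polyfuns :: "nat \<Rightarrow> polyfun set" where
  "polyfuns 0 = range (\<lambda>c \<rho>. c)"
| "polyfuns (Suc n) = adjoin (polyfuns n) (\<lambda>\<rho>. \<rho> n)"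

lemma subring_polyfuns: "subring (polyfuns n)"
proof (induction n)
  case 0
  show ?case by (auto simp: subring_def plus_fun_def times_fun_def one_fun_def fun_eq_iff)
qed (simp add: subring_adjoin)

lemma noetherian_polyfuns: "noetherian (polyfuns n)"
proof (induction n)
  case 0
  show ?case
    unfolding noetherian_def
  proof (intro allI impI)
    fix S :: "polyfun set" assume S: "S \<subseteq> polyfuns 0"
    show "\<exists>T. T \<subseteq> S \<and> finite T \<and> S \<subseteq> idl (polyfuns 0) T"
    proof (cases "S \<subseteq> {0}")
      case True
      then have "S \<subseteq> idl (polyfuns 0) {}" using idl.zero[of "polyfuns 0" "{}"] by blast
      then show ?thesis by blast
    next
      case False
      \<comment> \<open>The constants form a field, so one nonzero element generates all of
        them.\<close>
      then obtain s where s: "s \<in> S" "s \<noteq> 0" by blast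
      then obtain c where c: "s = (\<lambda>\<rho>. c)" using S by auto
      then have "c \<noteq> 0" using s by (auto simp: zero_fun_def)
      have "g \<in> idl (polyfuns 0) {s}" if gS: "g \<in> S" for g
      proof -
        obtain d where d: "g = (\<lambda>\<rho>. d)" using subsetD[OF S gS] by auto
        have "(\<lambda>\<rho>. d / c) * s + 0 \<in> idl (polyfuns 0) {s}"
          by (rule idl.step) (auto intro: idl.zero)
        moreover have "(\<lambda>\<rho>. d / c) * s + 0 = g" using \<open>c \<noteq> 0\<close> by (simp add: c d fun_eq_iff)
        ultimately show ?thesis by simp
      qed
      then show ?thesis using s by (intro exI[of _ "{s}"]) auto
    qed
  qed
qed (simp add: noetherian_adjoin subring_polyfuns)

lemma var_in_polyfuns: "x < n \<Longrightarrow> (\<lambda>\<rho>. \<rho> x) \<in> polyfuns n"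
proof (induction n)
  case (Suc n)
  then show ?case
    using adjoin_self[OF subring_polyfuns[of n], of "\<lambda>\<rho>. \<rho> n"] adjoin_superset[OF subring_polyfuns[of n]]
    by (cases "x = n") auto
qed simp

lemma const_in_polyfuns: "(\<lambda>\<rho>. c) \<in> polyfuns n"
  by (induction n) (auto intro: adjoin_superset subring_polyfuns)

definition fn :: "trm \<Rightarrow> polyfun" where
  "fn t = (\<lambda>\<rho>. evalF \<rho> t)"

lemma fn_simps:
  "fn Zero = 0" "fn (Plus s t) = fn s + fn t" "fn (Times s t) = fn s * fn t" "fn (Scal c t) = (\<lambda>_. c) * fn t"
  by (simp_all add: fn_def fun_eq_iff)

lemma fn_in_polyfuns: "vars t \<subseteq> {..<n} \<Longrightarrow> fn t \<in> polyfuns n"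
proof (induction t)
  case (Var x)
  then show ?case by (simp add: fn_def var_in_polyfuns)
qed (simp_all add: fn_simps subringD[OF subring_polyfuns] const_in_polyfuns)

text \<open>Terms denote only polynomials without constant term; the constants, without which there
  is no unit, are added separately.\<close>

definition all_polyfuns :: "polyfun set" where
  "all_polyfuns = {(\<lambda>_. c) + fn t | c t. True}"

lemma all_polyfunsI: "(\<lambda>_. c) + fn t \<in> all_polyfuns"
  unfolding all_polyfuns_def by blast

lemma subring_all_polyfuns: "subring all_polyfuns"
  unfolding subring_def
proof (intro conjI ballI)
  show "1 \<in> all_polyfuns" "- 1 \<in> all_polyfuns"
    using all_polyfunsI[of 1 Zero] all_polyfunsI[of "- 1" Zero]
    by (simp_all add: fn_def plus_fun_def one_fun_def fun_Compl_def)
  fix f g assume "f \<in> all_polyfuns" "g \<in> all_polyfuns"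
  then obtain c s d t where fg: "f = (\<lambda>_. c) + fn s" "g = (\<lambda>_. d) + fn t"
    unfolding all_polyfuns_def by blast
  have "f + g = (\<lambda>_. c + d) + fn (Plus s t)" by (simp add: fg fn_def fun_eq_iff)
  then show "f + g \<in> all_polyfuns" using all_polyfunsI by simp
  have "f * g = (\<lambda>_. c * d) + fn (Plus (Scal c t) (Plus (Scal d s) (Times s t)))"
    by (simp add: fg fn_def fun_eq_iff algebra_simps)
  then show "f * g \<in> all_polyfuns" using all_polyfunsI by simp
qed

lemma fn_in_all_polyfuns: "fn t \<in> all_polyfuns"
  using all_polyfunsI[of 0 t] by (simp add: plus_fun_def)

lemma const_in_all_polyfuns: "(\<lambda>_. c) \<in> all_polyfuns"
  using all_polyfunsI[of c Zero] by (simp add: plus_fun_def fn_def)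

lemma polyfuns_subset: "polyfuns n \<subseteq> all_polyfuns"
proof (induction n)
  case (Suc n)
  have "(\<lambda>\<rho>. \<rho> n) \<in> all_polyfuns" using fn_in_all_polyfuns[of "Var n"] by (simp add: fn_def)
  then show ?case using Suc subring_all_polyfuns by (simp add: adjoin_subset)
qed (auto simp: const_in_all_polyfuns)

section \<open>Certificates of commutativity\<close>

lemma feq_iff_fn: "feq s t \<longleftrightarrow> fn s = fn t"
  by (simp add: feq_def fn_def fun_eq_iff)

lemma vars_subst: "vars (subst \<sigma> t) \<subseteq> (\<Union>x \<in> vars t. vars (\<sigma> x))"
  by (induction t) auto

lemma vars_app4:
  assumes "product_rule P"
  shows "vars (app4 P s1 s2 s3 s4) \<subseteq> vars s1 \<union> vars s2 \<union> vars s3 \<union> vars s4"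
  using vars_subst[of _ P] assms unfolding app4_def product_rule_def
  by (fastforce split: if_splits)

lemma vars_pext:
  assumes "product_rule P" "vars t \<subseteq> V" "V \<subseteq> W" "\<And>x. x \<in> V \<Longrightarrow> vars (D x) \<subseteq> W"
  shows "vars (pext P D t) \<subseteq> W"
  using assms(2)
proof (induction t)
  case (Times s t)
  then show ?case using vars_app4[OF assms(1), of s "pext P D s" t "pext P D t"] assms(3) by simp blast
qed (use assms(3,4) in auto)

lemma pext_cong: "(\<And>x. x \<in> vars t \<Longrightarrow> D x = D' x) \<Longrightarrow> pext P D t = pext P D' t"
  by (induction t) auto

lemma sem_Plus: "sem P F \<Delta> (Plus s t) w = sem P F \<Delta> s w + sem P F \<Delta> t w"
  by (induction w arbitrary: s t) simp_all

lemma sem_Scal: "sem P F \<Delta> (Scal c t) w = c * sem P F \<Delta> t w"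
  by (induction w arbitrary: t) simp_all

text \<open>All terms reached stay over \<open>V\<close>, so only the data on \<open>V\<close> and
  \<open>K\<close> matter. This identifies an automaton with its extension by a copy of the
  variables and with its decoded version.\<close>

lemma sem_cong:
  assumes "product_rule P" "vars t \<subseteq> V" "set w \<subseteq> K"
    "\<And>x. x \<in> V \<Longrightarrow> F x = F' x" "\<And>a x. a \<in> K \<Longrightarrow> x \<in> V \<Longrightarrow> \<Delta> a x = \<Delta>' a x"
    "\<And>a x. a \<in> K \<Longrightarrow> x \<in> V \<Longrightarrow> vars (\<Delta> a x) \<subseteq> V"
  shows "sem P F \<Delta> t w = sem P F' \<Delta>' t w"
  using assms(2,3)
proof (induction w arbitrary: t)
  case Nil
  then show ?case using assms(4) by (auto intro: evalF_cong)
next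
  case (Cons a w)
  have "pext P (\<Delta> a) t = pext P (\<Delta>' a) t" using Cons.prems assms(5) by (intro pext_cong) auto
  moreover have "vars (pext P (\<Delta> a) t) \<subseteq> V"
    using Cons.prems assms(6) by (intro vars_pext[OF assms(1), of _ V]) auto
  ultimately show ?case using Cons by simp
qed

primrec run :: "trm \<Rightarrow> (nat \<Rightarrow> nat \<Rightarrow> trm) \<Rightarrow> nat list \<Rightarrow> trm \<Rightarrow> trm" where
  "run P \<Delta> [] t = t"
| "run P \<Delta> (a # w) t = run P \<Delta> w (pext P (\<Delta> a) t)"

lemma sem_run: "sem P F \<Delta> t w = evalF F (run P \<Delta> w t)"
  by (induction w arbitrary: t) simp_all

lemma run_append: "run P \<Delta> (u @ v) t = run P \<Delta> v (run P \<Delta> u t)"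
  by (induction u arbitrary: t) simp_all

lemma vars_run:
  assumes "product_rule P" "\<And>a x. vars (\<Delta> a x) \<subseteq> V" "vars t \<subseteq> V"
  shows "vars (run P \<Delta> w t) \<subseteq> V"
  using assms(3)
proof (induction w arbitrary: t)
  case (Cons a w)
  then show ?case using vars_pext[OF assms(1) Cons.prems, of V "\<Delta> a"] assms(2) by simp
qed simp

text \<open>The variable \<open>n + x\<close> stands for the right derivative of \<open>x\<close>.  The letter of that derivative enters
  only through the output function \<open>rout\<close>.\<close>

definition rdelta :: "trm \<Rightarrow> nat \<Rightarrow> (nat \<Rightarrow> nat \<Rightarrow> trm) \<Rightarrow> nat \<Rightarrow> nat \<Rightarrow> trm" where
  "rdelta P n \<Delta> b x = (if x < n then \<Delta> b x else pext P (\<lambda>y. Var (n + y)) (\<Delta> b (x - n)))"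

definition rout :: "nat \<Rightarrow> (nat \<Rightarrow> rat) \<Rightarrow> (nat \<Rightarrow> nat \<Rightarrow> trm) \<Rightarrow> nat \<Rightarrow> nat \<Rightarrow> rat" where
  "rout n F \<Delta> a x = (if x < n then F x else evalF F (\<Delta> a (x - n)))"

text \<open>Coefficients may use all variables, so cofactors in a certificate can be arbitrary
  terms.\<close>

definition ideal_of :: "trm list \<Rightarrow> polyfun set" where
  "ideal_of G = idl all_polyfuns (fn ` set G)"

definition zero_cert :: "trm \<Rightarrow> nat \<Rightarrow> (nat \<Rightarrow> rat) \<Rightarrow> (nat \<Rightarrow> nat \<Rightarrow> trm) \<Rightarrow> trm set \<Rightarrow> trm list \<Rightarrow> bool" where
  "zero_cert P k F \<Delta> ts G \<longleftrightarrow> (\<forall>g \<in> set G. evalF F g = 0) \<and> (\<forall>t \<in> ts. fn t \<in> ideal_of G) \<and>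
     (\<forall>g \<in> set G. \<forall>b < k. fn (pext P (\<Delta> b) g) \<in> ideal_of G)"

lemma ideal_of_simps:
  "f \<in> ideal_of G \<Longrightarrow> g \<in> ideal_of G \<Longrightarrow> f + g \<in> ideal_of G"
  "f \<in> ideal_of G \<Longrightarrow> fn t * f \<in> ideal_of G"
  "f \<in> ideal_of G \<Longrightarrow> (\<lambda>_. c) * f \<in> ideal_of G"
  unfolding ideal_of_def
  by (auto intro: idl_add idl_mult subring_all_polyfuns fn_in_all_polyfuns const_in_all_polyfuns)

lemma ideal_of_vanishes:
  assumes "f \<in> ideal_of G" "\<forall>g \<in> set G. evalF F g = 0"
  shows "f F = 0"
  using assms(1) unfolding ideal_of_def
  by (induction rule: idl.induct) (use assms(2) in \<open>auto simp: fn_def\<close>)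

context bilinear_rule
begin

text \<open>The normal form of P as a term rather than as a value, so that a further
  \<open>pext\<close> can be applied to it.\<close>

definition bil :: "trm \<Rightarrow> trm \<Rightarrow> trm \<Rightarrow> trm \<Rightarrow> trm" where
  "bil s1 s2 s3 s4 = Plus (Scal \<alpha> (Times s1 s3))
     (Plus (Scal \<beta> (Plus (Times s1 s4) (Times s2 s3))) (Scal \<gamma> (Times s2 s4)))"

lemma feq_app4_bil: "feq (app4 P s1 s2 s3 s4) (bil s1 s2 s3 s4)"
  by (simp add: feq_def bil_def evalF_app4)

lemma sem_feq: "feq s t \<Longrightarrow> sem P F \<Delta> s w = sem P F \<Delta> t w"
proof (induction w arbitrary: s t)
  case (Cons a w)
  then show ?case using pext_feq by simp
qed (simp add: feq_def)

text \<open>For products, bilinearity of \<open>P\<close> expands both sides to the same sum, over pairs of terms of the two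
  product rules.\<close>

lemma pext_rdelta_commute:
  fixes \<Delta> :: "nat \<Rightarrow> nat \<Rightarrow> trm" and n :: nat
  defines "R \<equiv> pext P (\<lambda>y. Var (n + y))"
  assumes "vars t \<subseteq> {..<n}"
  shows "feq (pext P (rdelta P n \<Delta> b) (R t)) (R (pext P (\<Delta> b) t))"
  using assms(2)
proof (induction t)
  case (Var x)
  then show ?case by (simp add: R_def rdelta_def feq_def)
next
  case (Times s t)
  define L L' where "L = pext P (\<Delta> b)" and "L' = pext P (rdelta P n \<Delta> b)"
  \<comment> \<open>Both factors use only variables below \<open>n\<close>, where
    \<open>rdelta\<close> is the original transition.\<close>
  have LL': "L' s = L s" "L' t = L t"
    unfolding L_def L'_def using Times.prems by (auto intro!: pext_cong simp: rdelta_def)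
  have IH: "evalF \<rho> (L' (R s)) = evalF \<rho> (R (L s))" "evalF \<rho> (L' (R t)) = evalF \<rho> (R (L t))" for \<rho>
    using Times by (simp_all add: feq_def L_def L'_def)
  have "evalF \<rho> (L' (R (Times s t))) = evalF \<rho> (R (L (Times s t)))" for \<rho>
  proof -
    have "evalF \<rho> (L' (R (Times s t))) = evalF \<rho> (L' (bil s (R s) t (R t)))"
      using pext_feq[OF feq_app4_bil] by (simp add: R_def L'_def feq_def)
    also have "\<dots> = evalF \<rho> (R (bil s (L s) t (L t)))"
      using LL' IH[of \<rho>] unfolding R_def L'_def
      by (simp add: bil_def evalF_app4 algebra_simps)
    also have "\<dots> = evalF \<rho> (R (L (Times s t)))"
      using pext_feq[OF feq_app4_bil] by (simp add: R_def L_def feq_def)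
    finally show ?thesis .
  qed
  then show ?case by (simp add: feq_def L_def L'_def)
qed (simp_all add: R_def feq_def)

text \<open>Commutation moves the right derivative past the letters of \<open>w\<close>. At the end
  of the word the variable \<open>n + y\<close> is evaluated by \<open>rout\<close> as the value of
  \<open>\<Delta> a y\<close>, which amounts to reading \<open>a\<close> last.\<close>

lemma sem_right_derivative:
  assumes "product_rule P" "\<And>a x. vars (\<Delta> a x) \<subseteq> {..<n}" "vars t \<subseteq> {..<n}"
  shows "sem P (rout n F \<Delta> a) (rdelta P n \<Delta>) (pext P (\<lambda>y. Var (n + y)) t) w = sem P F \<Delta> t (w @ [a])"
  using assms(3)
proof (induction w arbitrary: t)
  case Nil
  then have "evalF (rout n F \<Delta> a) (pext P (\<lambda>y. Var (n + y)) t) = evalF F (pext P (\<Delta> a) t)"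
  proof (induction t)
    case (Times s t)
    have "evalF (rout n F \<Delta> a) s = evalF F s" "evalF (rout n F \<Delta> a) t = evalF F t"
      using Times.prems by (auto intro!: evalF_cong simp: rout_def)
    then show ?case using Times by (simp add: evalF_app4)
  qed (simp_all add: rout_def)
  then show ?case by simp
next
  case (Cons b w)
  have "vars (pext P (\<Delta> b) t) \<subseteq> {..<n}"
    using Cons.prems assms(2) by (intro vars_pext[OF assms(1)]) auto
  from Cons.IH[OF this] show ?case
    using sem_feq[OF pext_rdelta_commute[OF Cons.prems]] by simp
qed

text \<open>Elements of the ideal are functions, whereas \<open>pext\<close> acts on terms. The
  induction builds some term for each element whose P-extension stays in the ideal;
  \<open>pext_feq\<close> then transfers this to the given term.\<close>

lemma ideal_of_pext:
  assumes "fn t \<in> ideal_of G" "\<And>g. g \<in> set G \<Longrightarrow> fn (pext P D g) \<in> ideal_of G"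
  shows "fn (pext P D t) \<in> ideal_of G"
proof -
  have "\<exists>u. fn u = f \<and> fn (pext P D u) \<in> ideal_of G" if "f \<in> ideal_of G" for f
    using that unfolding ideal_of_def
  proof (induction rule: idl.induct)
    case zero
    show ?case by (intro exI[of _ Zero]) (simp only: pext.simps fn_simps idl.zero simp_thms)
  next
    case (step a g h)
    then obtain u where u: "fn u = h" "fn (pext P D u) \<in> ideal_of G" by (auto simp: ideal_of_def)
    obtain g0 where g0: "g0 \<in> set G" "g = fn g0" using step by blast
    obtain c q where a: "a = (\<lambda>_. c) + fn q" using step by (auto simp: all_polyfuns_def)
    \<comment> \<open>The coefficient \<open>c + q\<close> is not a term, as constants are lacking;
      its constant part acts through \<open>Scal\<close> and only \<open>q\<close> through a
      product.\<close>
    define u' where "u' = Plus (Plus (Scal c g0) (Times q g0)) u"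
    have g0I: "fn g0 \<in> ideal_of G"
      unfolding ideal_of_def using g0 by (intro idl_base subring_all_polyfuns) simp
    note dg = assms(2)[OF g0(1)]
    have "fn (app4 P q (pext P D q) g0 (pext P D g0)) = fn (bil q (pext P D q) g0 (pext P D g0))"
      using feq_app4_bil by (simp add: feq_iff_fn)
    moreover have "fn (bil q (pext P D q) g0 (pext P D g0)) \<in> ideal_of G"
      unfolding bil_def fn_simps by (intro ideal_of_simps g0I dg)
    ultimately have "fn (pext P D u') \<in> ideal_of G"
      using u(2) dg by (simp add: u'_def fn_simps ideal_of_simps)
    moreover have "fn u' = a * g + h"
      by (simp add: u'_def fn_simps u a g0 distrib_right)
    ultimately show ?case unfolding ideal_of_def by blast
  qed
  from this[OF assms(1)] obtain u where u: "fn u = fn t" "fn (pext P D u) \<in> ideal_of G" by blast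
  then show ?thesis using pext_feq[of u t D] by (simp add: feq_iff_fn)
qed

lemma zero_cert_sound:
  assumes "zero_cert P k F \<Delta> ts G" "t \<in> ts" "set w \<subseteq> {..<k}"
  shows "sem P F \<Delta> t w = 0"
proof -
  have "fn t \<in> ideal_of G \<Longrightarrow> set w \<subseteq> {..<k} \<Longrightarrow> sem P F \<Delta> t w = 0" for t
  proof (induction w arbitrary: t)
    case Nil
    then have "fn t F = 0" using assms(1) by (intro ideal_of_vanishes) (auto simp: zero_cert_def)
    then show ?case by (simp add: fn_def)
  next
    case (Cons b w)
    have "fn (pext P (\<Delta> b) t) \<in> ideal_of G"
      using Cons.prems assms(1) by (auto simp: zero_cert_def intro: ideal_of_pext[OF Cons.prems(1)])
    then show ?case using Cons by simp
  qed
  then show ?thesis using assms by (auto simp: zero_cert_def)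
qed

text \<open>The ideal generated by all terms reachable from \<open>ts\<close> works: a reachable
  term has output 0, being a value of a zero series, and its successors are reachable.\<close>

lemma zero_cert_complete:
  assumes "product_rule P" "\<And>a x. vars (\<Delta> a x) \<subseteq> {..<N}" "\<And>t. t \<in> ts \<Longrightarrow> vars t \<subseteq> {..<N}"
    and zero: "\<And>t w. t \<in> ts \<Longrightarrow> set w \<subseteq> {..<k} \<Longrightarrow> sem P F \<Delta> t w = 0"
  shows "\<exists>G. zero_cert P k F \<Delta> ts G"
proof -
  define S where "S = {run P \<Delta> w t | w t. t \<in> ts \<and> set w \<subseteq> {..<k}}"
  have "fn ` S \<subseteq> polyfuns N"
  proof
    fix f assume "f \<in> fn ` S"
    then obtain w t where "f = fn (run P \<Delta> w t)" "t \<in> ts" by (auto simp: S_def)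
    then show "f \<in> polyfuns N"
      using vars_run[OF assms(1,2) assms(3)] by (simp add: fn_in_polyfuns)
  qed
  from noetherianD[OF noetherian_polyfuns this]
  obtain T where T: "T \<subseteq> fn ` S" "finite T" "fn ` S \<subseteq> idl (polyfuns N) T"
    by (elim exE conjE)
  obtain S0 where S0: "S0 \<subseteq> S" "finite S0" "T = fn ` S0"
    using finite_subset_image[OF T(2,1)] by blast
  obtain G where G: "set G = S0" using finite_list[OF S0(2)] by blast
  have mem: "fn s \<in> ideal_of G" if "s \<in> S" for s
  proof -
    have "fn s \<in> idl (polyfuns N) T" using T(3) that by blast
    \<comment> \<open>Noetherianity was used in \<open>N\<close> variables; enlarging the
      coefficient ring preserves membership.\<close>
    then show ?thesis unfolding ideal_of_def G S0(3)
      by (rule idl_mono[OF _ polyfuns_subset]) simp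
  qed
  have "evalF F g = 0" if "g \<in> S" for g
    using that zero by (auto simp: S_def sem_run)
  moreover have "t \<in> S" if "t \<in> ts" for t
    unfolding S_def using that by (auto intro!: exI[of _ "[]"])
  moreover have "pext P (\<Delta> b) g \<in> S" if g: "g \<in> S" and b: "b < k" for g b
  proof -
    obtain w t where w: "g = run P \<Delta> w t" "t \<in> ts" "set w \<subseteq> {..<k}" using g by (auto simp: S_def)
    then have "pext P (\<Delta> b) g = run P \<Delta> (w @ [b]) t" by (simp add: run_append)
    moreover have "set (w @ [b]) \<subseteq> {..<k}" using w b by simp
    ultimately show ?thesis using w(2) unfolding S_def by blast
  qed
  ultimately have "zero_cert P k F \<Delta> ts G"
    unfolding zero_cert_def using S0(1) G mem by auto
  then show ?thesis ..
qed

end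

section \<open>Reduction of commutativity to zeroness\<close>

lemma commutative_series_iff:
  "commutative_series k f \<longleftrightarrow>
     (\<forall>a<k. \<forall>b<k. \<forall>w. set w \<subseteq> {..<k} \<longrightarrow> f (a # b # w) = f (b # a # w)) \<and>
     (\<forall>a<k. \<forall>w. set w \<subseteq> {..<k} \<longrightarrow> f (a # w) = f (w @ [a]))" (is "_ \<longleftrightarrow> ?swap \<and> ?rot")
proof
  assume c: "commutative_series k f"
  show "?swap \<and> ?rot"
  proof (intro conjI allI impI)
    fix a b w assume "a < k" "b < k" "set w \<subseteq> {..<k}"
    then show "f (a # b # w) = f (b # a # w)"
      by (intro c[unfolded commutative_series_def, rule_format]) auto
  next
    fix a w assume "a < k" "set w \<subseteq> {..<k}"
    then show "f (a # w) = f (w @ [a])"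
      by (intro c[unfolded commutative_series_def, rule_format]) auto
  qed
next
  assume "?swap \<and> ?rot"
  then have swap: "\<And>a b w. a < k \<Longrightarrow> b < k \<Longrightarrow> set w \<subseteq> {..<k} \<Longrightarrow> f (a # b # w) = f (b # a # w)"
    and rot1: "\<And>a w. a < k \<Longrightarrow> set w \<subseteq> {..<k} \<Longrightarrow> f (a # w) = f (w @ [a])" by blast+
  have rot: "f (u @ v) = f (v @ u)" if "set u \<subseteq> {..<k}" "set v \<subseteq> {..<k}" for u v
    using that
  proof (induction u arbitrary: v)
    case (Cons a u)
    have "f ((a # u) @ v) = f (u @ (v @ [a]))" using rot1[of a "u @ v"] Cons.prems by simp
    also have "\<dots> = f ((v @ [a]) @ u)" using Cons by (intro Cons.IH) auto
    finally show ?case by simp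
  qed simp
  \<comment> \<open>Rotate the prefix to the end, exchange the first two letters, and rotate
    back.\<close>
  have swap_mid: "f (p @ a # b # s) = f (p @ b # a # s)"
    if "a < k" "b < k" "set p \<subseteq> {..<k}" "set s \<subseteq> {..<k}" for p a b s
    using rot[of p "a # b # s"] rot[of p "b # a # s"] swap[of a b "s @ p"] that by simp
  have move: "f (p @ v @ a # s) = f (p @ a # v @ s)"
    if "a < k" "set p \<subseteq> {..<k}" "set v \<subseteq> {..<k}" "set s \<subseteq> {..<k}" for p v a s
    using that
  proof (induction v arbitrary: p)
    case (Cons b v)
    have "f (p @ (b # v) @ a # s) = f ((p @ [b]) @ a # v @ s)"
      using Cons.IH[of "p @ [b]"] Cons.prems by simp
    also have "\<dots> = f (p @ a # (b # v) @ s)" using swap_mid[of b a p "v @ s"] Cons.prems by simp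
    finally show ?case .
  qed simp
  \<comment> \<open>The prefix \<open>p\<close> collects the letters already matched, so the
    induction never leaves the front of the word.\<close>
  have perm: "f (p @ u) = f (p @ v)"
    if "mset u = mset v" "set p \<subseteq> {..<k}" "set u \<subseteq> {..<k}" for p u v
    using that
  proof (induction u arbitrary: p v)
    case (Cons a u)
    then have "a \<in> set v" by (metis list.set_intros(1) mset_eq_setD)
    then obtain v1 v2 where v: "v = v1 @ a # v2" by (meson split_list)
    have sets: "set v1 \<subseteq> {..<k}" "set v2 \<subseteq> {..<k}" "a < k"
      using Cons.prems mset_eq_setD[OF Cons.prems(1)] v by auto
    have "f (p @ a # u) = f ((p @ [a]) @ (v1 @ v2))"
      using Cons.prems v Cons.IH[of "v1 @ v2" "p @ [a]"] by simp
    also have "\<dots> = f (p @ v)" using move[of a p v1 v2] sets Cons.prems v by simp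
    finally show ?case .
  qed simp
  show "commutative_series k f"
    unfolding commutative_series_def
  proof (intro allI impI)
    fix u v assume "set u \<subseteq> {..<k}" "\<forall>a. count_list u a = count_list v a"
    then show "f u = f v" using perm[of u v "[]"]
      by (simp add: multiset_eq_iff count_mset)
  qed
qed

text \<open>Their series are the differences of f(aw) and f(wa) and of f(bcw) and f(cbw). The output
  function of the right derivative depends on \<open>a\<close>, so there is one certificate per
  letter. The exchange terms are repeated in each, which also fits an empty alphabet.\<close>

definition comm_targets :: "trm \<Rightarrow> nat \<Rightarrow> nat \<Rightarrow> (nat \<Rightarrow> nat \<Rightarrow> trm) \<Rightarrow> nat \<Rightarrow> nat \<Rightarrow> trm set" where
  "comm_targets P k n \<Delta> x a =
     insert (Plus (\<Delta> a x) (Scal (- 1) (Var (n + x))))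
       {Plus (pext P (\<Delta> c) (\<Delta> b x)) (Scal (- 1) (pext P (\<Delta> b) (\<Delta> c x))) | b c. b < k \<and> c < k}"

lemma ball_comm_targets:
  "(\<forall>t \<in> comm_targets P k n \<Delta> x a. Q t) \<longleftrightarrow> Q (Plus (\<Delta> a x) (Scal (- 1) (Var (n + x)))) \<and>
     (\<forall>b<k. \<forall>c<k. Q (Plus (pext P (\<Delta> c) (\<Delta> b x)) (Scal (- 1) (pext P (\<Delta> b) (\<Delta> c x)))))"
  unfolding comm_targets_def by auto

theorem commutative_iff_cert:
  assumes P: "product_rule P" "special P" and closed: "\<And>a x. vars (\<Delta> a x) \<subseteq> {..<n}" and x: "x < n"
  shows "commutative_series k (sem P F \<Delta> (Var x)) \<longleftrightarrow>
    (\<forall>a<k. \<exists>G. zero_cert P k (rout n F \<Delta> a) (rdelta P n \<Delta>) (comm_targets P k n \<Delta> x a) G)"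
proof -
  obtain \<alpha> \<beta> \<gamma> where "bilinear_rule P \<alpha> \<beta> \<gamma>" using special_bilinear[OF P] .
  then interpret bilinear_rule P \<alpha> \<beta> \<gamma> .
  define f where "f = sem P F \<Delta> (Var x)"
  define s where "s a = sem P (rout n F \<Delta> a) (rdelta P n \<Delta>)" for a
  \<comment> \<open>On terms without the copied variables the extended automaton computes the
    original series.\<close>
  have base: "s a t w = sem P F \<Delta> t w" if "vars t \<subseteq> {..<n}" for a t w
    unfolding s_def using that closed
    by (intro sem_cong[OF P(1), where V = "{..<n}" and K = UNIV, symmetric]) (auto simp: rout_def rdelta_def)
  have vars_pext_n: "vars (pext P (\<Delta> b) t) \<subseteq> {..<n}" if "vars t \<subseteq> {..<n}" for b t
    using that closed by (intro vars_pext[OF P(1)]) auto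
  have s_rot: "s a (Plus (\<Delta> a x) (Scal (- 1) (Var (n + x)))) w = f (a # w) - f (w @ [a])" for a w
    using base[where t = "\<Delta> a x" and a = a and w = w, OF closed] sem_right_derivative[where t = "Var x" and F = F and a = a and w = w, OF P(1) closed] x
    by (simp add: s_def sem_Plus sem_Scal f_def)
  have s_swap: "s a (Plus (pext P (\<Delta> c) (\<Delta> b x)) (Scal (- 1) (pext P (\<Delta> b) (\<Delta> c x)))) w
      = f (b # c # w) - f (c # b # w)" for a b c w
    using base[where t = "pext P (\<Delta> c) (\<Delta> b x)" and a = a and w = w, OF vars_pext_n[OF closed]]
      base[where t = "pext P (\<Delta> b) (\<Delta> c x)" and a = a and w = w, OF vars_pext_n[OF closed]]
    by (simp add: s_def sem_Plus sem_Scal f_def)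
  have comm: "commutative_series k f \<longleftrightarrow>
      (\<forall>a<k. \<forall>t \<in> comm_targets P k n \<Delta> x a. \<forall>w. set w \<subseteq> {..<k} \<longrightarrow> s a t w = 0)"
    unfolding commutative_series_iff ball_comm_targets s_rot s_swap right_minus_eq by auto
  have vars_rdelta: "vars (rdelta P n \<Delta> a y) \<subseteq> {..<2 * n}" for a y
  proof (cases "y < n")
    case True
    then show ?thesis using closed[of a y] by (auto simp: rdelta_def)
  next
    case False
    have "vars (pext P (\<lambda>y. Var (n + y)) (\<Delta> a (y - n))) \<subseteq> {..<2 * n}"
      by (rule vars_pext[OF P(1) closed]) auto
    then show ?thesis using False by (simp add: rdelta_def)
  qed
  have sub: "{..<n} \<subseteq> {..<2 * n}" by auto
  have vars_targets: "vars t \<subseteq> {..<2 * n}" if "t \<in> comm_targets P k n \<Delta> x a" for t a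
  proof -
    have "\<forall>t \<in> comm_targets P k n \<Delta> x a. vars t \<subseteq> {..<2 * n}"
      unfolding ball_comm_targets
      using x closed vars_pext_n[OF closed] sub by (simp add: order.trans[OF _ sub])
    then show ?thesis using that by blast
  qed
  show ?thesis
    unfolding f_def[symmetric] comm
  proof (intro all_cong1 imp_cong refl iffI)
    fix a assume "\<forall>t \<in> comm_targets P k n \<Delta> x a. \<forall>w. set w \<subseteq> {..<k} \<longrightarrow> s a t w = 0"
    then show "\<exists>G. zero_cert P k (rout n F \<Delta> a) (rdelta P n \<Delta>) (comm_targets P k n \<Delta> x a) G"
      unfolding s_def by (intro zero_cert_complete[OF P(1) vars_rdelta vars_targets]) auto
  next
    fix a assume "\<exists>G. zero_cert P k (rout n F \<Delta> a) (rdelta P n \<Delta>) (comm_targets P k n \<Delta> x a) G"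
    then show "\<forall>t \<in> comm_targets P k n \<Delta> x a. \<forall>w. set w \<subseteq> {..<k} \<longrightarrow> s a t w = 0"
      unfolding s_def using zero_cert_sound by blast
  qed
qed

section \<open>Checking certificates\<close>

text \<open>One crude bound with two uses: it exceeds every variable index and bounds the degree in
  each variable.\<close>

fun weight :: "trm \<Rightarrow> nat" where
  "weight (Var x) = Suc x"
| "weight Zero = 0"
| "weight (Scal c t) = weight t"
| "weight (Plus s t) = weight s + weight t"
| "weight (Times s t) = weight s + weight t"

lemma vars_weight: "vars t \<subseteq> {..<weight t}"
  by (induction t) auto

lemma degree_eval_poly:
  assumes "\<And>i. degree (\<sigma> i) \<le> 1"
  shows "degree (eval_poly \<sigma> t) \<le> weight t"
proof (induction t)
  case (Var x)
  then show ?case using assms[of x] by simp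
next
  case (Scal c t)
  then show ?case using degree_smult_le[of c "eval_poly \<sigma> t"] by simp
next
  case (Plus s t)
  then show ?case by (auto intro: degree_add_le)
next
  case (Times s t)
  then show ?case using degree_mult_le[of "eval_poly \<sigma> s" "eval_poly \<sigma> t"] by simp
qed simp

lemma digits_exist:
  assumes "\<And>i. r i \<le> d"
  shows "\<exists>m < Suc d ^ n. \<forall>i<n. m div Suc d ^ i mod Suc d = r i"
  using assms
proof (induction n arbitrary: r)
  case (Suc n)
  then obtain m where m: "m < Suc d ^ n" "\<And>i. i < n \<Longrightarrow> m div Suc d ^ i mod Suc d = r (Suc i)"
    using Suc.IH[of "\<lambda>i. r (Suc i)"] by blast
  define m' where "m' = r 0 + Suc d * m"
  have r0: "r 0 < Suc d" using Suc.prems[of 0] by simp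
  have "m' < Suc d * Suc m" using r0 by (simp add: m'_def)
  also have "\<dots> \<le> Suc d * Suc d ^ n" using m(1) by (intro mult_le_mono) simp_all
  finally have "m' < Suc d ^ Suc n" by simp
  moreover have "m' div Suc d ^ i mod Suc d = r i" if "i < Suc n" for i
  proof (cases i)
    case 0
    have "m' mod Suc d = r 0" unfolding m'_def mod_mult_self2 using r0 by (rule mod_less)
    then show ?thesis using 0 by simp
  next
    case (Suc j)
    have "m' div Suc d = m" unfolding m'_def using r0 by (simp del: mult_Suc)
    then have "m' div Suc d ^ i = m div Suc d ^ j"
      by (simp only: Suc power_Suc div_mult2_eq)
    then show ?thesis using m(2)[of j] that Suc by simp
  qed
  ultimately show ?case by blast
qed simp

text \<open>A polynomial of degree at most \<open>d\<close> in each of its at most \<open>d\<close> variables vanishes if it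
  vanishes on the grid \<open>{0, \<dots>, d}^d\<close>, whose points are enumerated by the base \<open>d + 1\<close> digits.\<close>

lemma vanishes_iff_grid:
  fixes t :: trm
  defines "d \<equiv> weight t"
  shows "(\<forall>\<rho>. evalF \<rho> t = 0) \<longleftrightarrow>
    (\<forall>m < Suc d ^ d. evalF (\<lambda>i. of_nat (m div Suc d ^ i mod Suc d)) t = 0)"
proof
  assume grid: "\<forall>m < Suc d ^ d. evalF (\<lambda>i. of_nat (m div Suc d ^ i mod Suc d)) t = 0"
  \<comment> \<open>Coordinates below \<open>j\<close> are free, those from \<open>j\<close> to
    \<open>d - 1\<close> lie on the grid. To free coordinate \<open>j\<close>, vary it alone: a
    polynomial of degree at most \<open>d\<close> with \<open>d + 1\<close> roots is 0.\<close>
  have "\<forall>\<rho>. (\<forall>i. j \<le> i \<longrightarrow> i < d \<longrightarrow> \<rho> i \<in> of_nat ` {..d}) \<longrightarrow> evalF \<rho> t = 0" for j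
  proof (induction j)
    case 0
    show ?case
    proof (intro allI impI)
      fix \<rho> :: "nat \<Rightarrow> rat" assume \<rho>: "\<forall>i. 0 \<le> i \<longrightarrow> i < d \<longrightarrow> \<rho> i \<in> of_nat ` {..d}"
      have "\<exists>r. i < d \<longrightarrow> \<rho> i = of_nat r \<and> r \<le> d" for i using \<rho> by blast
      then obtain r where r: "\<And>i. i < d \<Longrightarrow> \<rho> i = of_nat (r i) \<and> r i \<le> d" by metis
      \<comment> \<open>The minimum bounds the digits at all indices, as \<open>digits_exist\<close>
        demands; below \<open>d\<close> it changes nothing.\<close>
      obtain m where m: "m < Suc d ^ d" "\<And>i. i < d \<Longrightarrow> m div Suc d ^ i mod Suc d = min (r i) d"
        using digits_exist[of "\<lambda>i. min (r i) d" d d] by auto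
      have "evalF \<rho> t = evalF (\<lambda>i. of_nat (m div Suc d ^ i mod Suc d)) t"
      proof (rule evalF_cong)
        fix x assume "x \<in> vars t"
        then have "x < d" using vars_weight[of t] by (auto simp: d_def)
        then show "\<rho> x = of_nat (m div Suc d ^ x mod Suc d)" using r m by simp
      qed
      then show "evalF \<rho> t = 0" using grid m(1) by simp
    qed
  next
    case (Suc j)
    show ?case
    proof (intro allI impI)
      fix \<rho> :: "nat \<Rightarrow> rat" assume \<rho>: "\<forall>i. Suc j \<le> i \<longrightarrow> i < d \<longrightarrow> \<rho> i \<in> of_nat ` {..d}"
      define \<sigma> where "\<sigma> i = (if i = j then [:0, 1:] else [:\<rho> i:])" for i
      define p where "p = eval_poly \<sigma> t"
      have p: "poly p x = evalF (\<rho>(j := x)) t" for x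
        unfolding p_def poly_eval_poly by (rule arg_cong[of _ _ "\<lambda>\<rho>. evalF \<rho> t"]) (auto simp: \<sigma>_def)
      have "degree p \<le> d"
        unfolding p_def d_def by (rule degree_eval_poly) (simp add: \<sigma>_def)
      moreover have roots: "of_nat ` {..d} \<subseteq> {x. poly p x = 0}"
        using Suc \<rho> by (auto simp: p)
      have "p = 0"
      proof (rule ccontr)
        assume "p \<noteq> 0"
        then have "card ((of_nat :: nat \<Rightarrow> rat) ` {..d}) \<le> degree p"
          using card_mono[OF poly_roots_finite roots] card_poly_roots_bound[of p] by linarith
        moreover have "card ((of_nat :: nat \<Rightarrow> rat) ` {..d}) = Suc d"
          by (simp add: card_image inj_on_def)
        ultimately show False using \<open>degree p \<le> d\<close> by simp
      qed
      then show "evalF \<rho> t = 0" using p[of "\<rho> j"] by simp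
    qed
  qed
  from this[of d] show "\<forall>\<rho>. evalF \<rho> t = 0" by simp
qed simp

text \<open>A cofactor list: the entry (i, c, q) contributes \<open>c + q\<close> times the
  generator with index i. An index out of range contributes zero, so every list is admissible and
  the search needs no side condition.\<close>

definition comb :: "trm list \<Rightarrow> (nat \<times> rat \<times> trm) list \<Rightarrow> trm" where
  "comb G qs = fold (\<lambda>q acc. Plus (Plus (Scal (fst (snd q)) (nthd Zero G (fst q)))
     (Times (snd (snd q)) (nthd Zero G (fst q)))) acc) qs Zero"

lemma ideal_of_iff_comb: "fn t \<in> ideal_of G \<longleftrightarrow> (\<exists>qs. feq t (comb G qs))"
proof
  have "\<exists>qs. f = fn (comb G qs)" if "f \<in> ideal_of G" for f
    using that unfolding ideal_of_def
  proof (induction rule: idl.induct)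
    case zero
    show ?case by (intro exI[of _ "[]"]) (simp only: comb_def fold_Nil id_apply fn_simps)
  next
    case (step a g h)
    then obtain qs where qs: "h = fn (comb G qs)" by blast
    obtain i where i: "i < length G" "g = fn (G ! i)" using step by (auto simp: in_set_conv_nth)
    obtain c q where a: "a = (\<lambda>_. c) + fn q" using step by (auto simp: all_polyfuns_def)
    have "a * g + h = fn (comb G (qs @ [(i, c, q)]))"
      by (simp add: comb_def fn_simps nthd_eq i a qs distrib_right)
    then show ?case ..
  qed
  then show "fn t \<in> ideal_of G \<Longrightarrow> \<exists>qs. feq t (comb G qs)" by (simp add: feq_iff_fn)
  have "fn (comb G qs) \<in> ideal_of G" for qs
  proof (induction qs rule: rev_induct)
    case Nil
    show ?case by (simp only: comb_def fold_Nil id_apply fn_simps ideal_of_def idl.zero)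
  next
    case (snoc q qs)
    have eq: "comb G (qs @ [q]) = Plus (Plus (Scal (fst (snd q)) (nthd Zero G (fst q)))
        (Times (snd (snd q)) (nthd Zero G (fst q)))) (comb G qs)" by (simp add: comb_def)
    have gen: "fn (nthd Zero G i) \<in> ideal_of G" for i
    proof (cases "i < length G")
      case True
      then show ?thesis
        unfolding ideal_of_def by (intro idl_base subring_all_polyfuns) (simp add: nthd_eq)
    next
      case False
      then show ?thesis
        by (simp only: nthd_eq if_False fn_simps ideal_of_def idl.zero)
    qed
    show ?case unfolding eq fn_simps by (intro ideal_of_simps gen snoc)
  qed
  then show "\<exists>qs. feq t (comb G qs) \<Longrightarrow> fn t \<in> ideal_of G" by (auto simp: feq_iff_fn)
qed

lemma computable_weight [comp_intros]:
  assumes "computable t"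
  shows "computable (\<lambda>e. weight (t e))"
  by (rule computable_trm_rec[where h = "\<lambda>_. weight" and f = "\<lambda>e. e" and g = t and fv = "\<lambda>_ x. Suc x" and fz = "\<lambda>_. 0" and fs = "\<lambda>_ _ _ r. r"
        and fp = "\<lambda>_ _ _ r r'. r + r'" and ft = "\<lambda>_ _ _ r r'. r + r'"])
    (simp_all add: comp_intros assms)

lemma computable_evalF [comp_intros]:
  assumes "computable (\<lambda>p. \<rho> (fst p) (snd p))" "computable t"
  shows "computable (\<lambda>e. evalF (\<rho> e) (t e))"
  by (rule computable_trm_rec[where h = "\<lambda>e. evalF (\<rho> e)" and fv = \<rho> and fz = "\<lambda>_. 0"
        and fs = "\<lambda>_ c _ r. c * r" and fp = "\<lambda>_ _ _ r r'. r + r'" and ft = "\<lambda>_ _ _ r r'. r * r'"])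
    (simp_all add: comp_intros assms)

text \<open>P is not part of the input, so structural induction on the fixed term builds the
  realizer.\<close>

lemma computable_app4 [comp_intros]:
  assumes "computable s1" "computable s2" "computable s3" "computable s4"
  shows "computable (\<lambda>e. app4 P (s1 e) (s2 e) (s3 e) (s4 e))"
proof -
  have "computable (\<lambda>e. subst (\<sigma> e) t)" if "\<And>i. computable (\<lambda>e. \<sigma> e i)" for t and \<sigma> :: "'a \<Rightarrow> nat \<Rightarrow> trm"
    by (induction t) (simp_all add: that comp_intros)
  then show ?thesis unfolding app4_def by (simp add: assms comp_intros)
qed

lemma computable_pext [comp_intros]:
  assumes "computable (\<lambda>p. D (fst p) (snd p))" "computable t"
  shows "computable (\<lambda>e. pext P (D e) (t e))"
  by (rule computable_trm_rec[where h = "\<lambda>e. pext P (D e)" and fv = D and fz = "\<lambda>_. Zero"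
        and fs = "\<lambda>_ c _ r. Scal c r" and fp = "\<lambda>_ _ _ r r'. Plus r r'"
        and ft = "\<lambda>_ s t r r'. app4 P s r t r'"])
    (simp_all add: comp_intros assms)

lemma computable_run [comp_intros]:
  assumes "computable (\<lambda>p. \<Delta> (fst (fst p)) (snd (fst p)) (snd p))" "computable w" "computable t"
  shows "computable (\<lambda>e. run P (\<Delta> e) (w e) (t e))"
proof -
  have eq: "run P \<Delta> w t = fold (\<lambda>a. pext P (\<Delta> a)) w t" for \<Delta> w t
    by (induction w arbitrary: t) simp_all
  have D: "computable (\<lambda>e. \<Delta> (x e) (a e) (y e))" if "computable x" "computable a" "computable y" for x a y
    using computable_compose[OF assms(1), of "\<lambda>e. ((x e, a e), y e)"] that by (simp add: comp_intros)
  show ?thesis unfolding eq by (intro comp_intros D assms(2,3))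
qed

lemma computable_feq [comp_intros]:
  assumes "computable s" "computable t"
  shows "computable (\<lambda>e. feq (s e) (t e))"
proof -
  have eq: "feq s t \<longleftrightarrow> (\<forall>\<rho>. evalF \<rho> (Plus s (Scal (- 1) t)) = 0)" for s t
    by (simp add: feq_def)
  note st = computable_compose[OF assms(1)] computable_compose[OF assms(2)]
  show ?thesis unfolding eq vanishes_iff_grid by (intro comp_intros st)
qed

lemma computable_comb [comp_intros]:
  assumes "computable G" "computable qs"
  shows "computable (\<lambda>e. comb (G e) (qs e))"
  unfolding comb_def by (intro comp_intros assms computable_compose[OF assms(1)])

lemma semidec_ideal_of:
  assumes "computable t" "computable G"
  shows "semidec (\<lambda>e. fn (t e) \<in> ideal_of (G e))"
  unfolding ideal_of_iff_comb
  by (intro semidec_ex semidec_computable comp_intros computable_compose[OF assms(1)] computable_compose[OF assms(2)])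

section \<open>Reading the encoded automaton and the two searches\<close>

definition in_letters :: "nat list \<Rightarrow> nat" where "in_letters I = nthd 0 I 0"
definition in_states :: "nat list \<Rightarrow> nat" where "in_states I = nthd 0 I 1"
definition in_out :: "nat list \<Rightarrow> nat \<Rightarrow> rat" where
  "in_out I x = nthd 0 (dec (nthd 0 I 2)) x"
text \<open>The default \<open>Zero\<close> has no variables, so for a valid input all transitions
  are terms over the states, even at letters and states out of range, as
  \<open>commutative_iff_cert\<close> demands.\<close>

definition in_delta :: "nat list \<Rightarrow> nat \<Rightarrow> nat \<Rightarrow> trm" where
  "in_delta I a x = nthd Zero (nthd [] (dec (nthd 0 I 3)) a) x"
definition in_start :: "nat list \<Rightarrow> nat" where "in_start I = nthd 0 I 4"

lemma computable_inputs [comp_intros]: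
  assumes "computable I"
  shows "computable (\<lambda>e. in_letters (I e))" "computable (\<lambda>e. in_states (I e))"
    "computable (\<lambda>e. in_start (I e))"
    "computable x \<Longrightarrow> computable (\<lambda>e. in_out (I e) (x e))"
    "computable a \<Longrightarrow> computable x \<Longrightarrow> computable (\<lambda>e. in_delta (I e) (a e) (x e))"
  unfolding in_letters_def in_states_def in_start_def in_out_def in_delta_def
  by (intro comp_intros assms; assumption)+

lemma computable_rout [comp_intros]:
  assumes I: "computable I" and a: "computable a" and "computable x"
  shows "computable (\<lambda>e. rout (in_states (I e)) (in_out (I e)) (in_delta (I e)) (a e) (x e))"
  unfolding rout_def
  by (intro comp_intros assms computable_compose[OF I] computable_compose[OF a])

lemma computable_rdelta [comp_intros]:
  assumes I: "computable I" and b: "computable b" and "computable x"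
  shows "computable (\<lambda>e. rdelta P (in_states (I e)) (in_delta (I e)) (b e) (x e))"
  unfolding rdelta_def
  by (intro comp_intros assms computable_compose[OF I] computable_compose[OF b])

lemma ball_set_nthd: "(\<forall>g \<in> set G. Q g) \<longleftrightarrow> (\<forall>j < length G. Q (nthd Zero G j))"
  by (auto simp: nthd_eq all_set_conv_all_nth)

definition comm_cert :: "trm \<Rightarrow> nat list \<Rightarrow> bool" where
  "comm_cert P I \<longleftrightarrow> (\<forall>a < in_letters I. \<exists>G.
     zero_cert P (in_letters I) (rout (in_states I) (in_out I) (in_delta I) a)
       (rdelta P (in_states I) (in_delta I))
       (comm_targets P (in_letters I) (in_states I) (in_delta I) (in_start I) a) G)"

text \<open>The generators and all cofactors are searched for; the remaining conditions are finitely
  many decidable identities.\<close>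

lemma semidec_comm_cert: "semidec (comm_cert P)"
  unfolding comm_cert_def[abs_def] zero_cert_def ball_comm_targets ball_set_nthd
  by (intro semidec_all_less semidec_ex semidec_conj semidec_ideal_of semidec_computable comp_intros)

text \<open>A violated exchange or rotation. Applying \<open>pext\<close> for \<open>a\<close> after
  the run on \<open>w\<close> reads the word \<open>w @ [a]\<close>.\<close>

definition noncomm_witness :: "trm \<Rightarrow> nat list \<Rightarrow> bool" where
  "noncomm_witness P I \<longleftrightarrow> (\<exists>q :: nat \<times> nat \<times> nat list.
     let a = fst q; b = fst (snd q); w = snd (snd q);
         s = \<lambda>u. run P (in_delta I) u (Var (in_start I)) in
     a < in_letters I \<and> b < in_letters I \<and> (\<forall>x \<in> set w. x < in_letters I) \<and>
     (evalF (in_out I) (s (a # b # w)) \<noteq> evalF (in_out I) (s (b # a # w)) \<or>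
      evalF (in_out I) (s (a # w)) \<noteq> evalF (in_out I) (pext P (in_delta I a) (s w))))"

lemma semidec_noncomm_witness: "semidec (noncomm_witness P)"
  unfolding noncomm_witness_def[abs_def] Let_def
  by (intro semidec_ex semidec_computable comp_intros)

lemma noncomm_witness_iff:
  "noncomm_witness P I \<longleftrightarrow>
     \<not> commutative_series (in_letters I) (sem P (in_out I) (in_delta I) (Var (in_start I)))"
proof -
  define f where "f = sem P (in_out I) (in_delta I) (Var (in_start I))"
  have run: "evalF (in_out I) (run P (in_delta I) u (Var (in_start I))) = f u" for u
    by (simp add: f_def sem_run)
  have run': "evalF (in_out I) (pext P (in_delta I a) (run P (in_delta I) w (Var (in_start I)))) = f (w @ [a])"
    for a w by (simp add: f_def sem_run run_append)
  have sub: "set w \<subseteq> {..<k} \<longleftrightarrow> (\<forall>x \<in> set w. x < k)" for w :: "nat list" and k by auto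
  show ?thesis
    unfolding noncomm_witness_def Let_def run run' f_def[symmetric] commutative_series_iff
      sub split_paired_Ex fst_conv snd_conv by blast
qed

theorem mainTheorem18:
  fixes P :: trm
  assumes "product_rule P" and "special P"
  shows "\<exists>prog :: recf. \<forall>k n Fs Ds x1. valid_input k n Fs Ds x1 \<longrightarrow>
           rec_eval prog [enc_input k n Fs Ds x1]
             (if commutative_series k (sem P (\<lambda>i. Fs ! i) (\<lambda>a i. Ds ! a ! i) (Var x1))
              then 1 else 0)"
proof -
  \<comment> \<open>The two predicates are complementary only where
    \<open>commutative_iff_cert\<close> applies, so the premise on \<open>c\<close> is discharged
    later from validity of the input.\<close>
  obtain prog where prog: "\<And>c. (comm_cert P (dec c) \<longleftrightarrow> \<not> noncomm_witness P (dec c)) \<Longrightarrow>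
      rec_eval prog [c] (if comm_cert P (dec c) then 1 else 0)"
    using semidec_decides[OF semidec_comm_cert semidec_noncomm_witness, of P P] by blast
  have "rec_eval prog [enc_input k n Fs Ds x1]
      (if commutative_series k (sem P (\<lambda>i. Fs ! i) (\<lambda>a i. Ds ! a ! i) (Var x1)) then 1 else 0)"
    if valid: "valid_input k n Fs Ds x1" for k n Fs Ds x1
  proof -
    define I :: "nat list" where "I = dec (enc_input k n Fs Ds x1)"
    have I: "I = [k, n, list_encode (map enc_rat Fs),
        list_encode (map (\<lambda>row. list_encode (map enc_trm row)) Ds), x1]"
      by (simp add: I_def enc_input_def dec_list_def dec_nat_def del: list_encode.simps)
    have "in_letters I = k" "in_states I = n" "in_start I = x1"
      by (simp_all add: I in_letters_def in_states_def in_start_def nthd_eq)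
    have out: "in_out I x = nthd 0 Fs x" for x
      by (simp add: I in_out_def nthd_eq[of 0 "[_, _, _, _, _]"] dec_list_def dec_enc_rat o_def
          del: list_encode.simps)
    have delta: "in_delta I a x = nthd Zero (nthd [] Ds a) x" for a x
      by (simp add: I in_delta_def nthd_eq[of 0 "[_, _, _, _, _]"] dec_list_def dec_trm_def dec_enc_term o_def
          del: list_encode.simps)
    note v = valid[unfolded valid_input_def]
    have vars_Ds: "vars (Ds ! a ! x) \<subseteq> {..<n}" if "a < k" "x < n" for a x
      using v that by (metis nth_mem)
    have rows: "length (Ds ! a) = n" if "a < k" for a
      using v that by (metis nth_mem)
    have closed: "vars (in_delta I a x) \<subseteq> {..<n}" for a x
      using v vars_Ds[of a x] rows[of a] by (cases "a < k \<and> x < n") (auto simp: delta nthd_eq)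
    have "sem P (\<lambda>i. Fs ! i) (\<lambda>a i. Ds ! a ! i) (Var x1) w = sem P (in_out I) (in_delta I) (Var x1) w"
      if "set w \<subseteq> {..<k}" for w
    proof (rule sem_cong[OF assms(1) _ that])
      show "vars (Var x1) \<subseteq> {..<n}" using v by simp
      show "Fs ! x = in_out I x" if "x \<in> {..<n}" for x
        using v that by (simp add: out nthd_eq)
      show "Ds ! a ! x = in_delta I a x" "vars (Ds ! a ! x) \<subseteq> {..<n}"
        if "a \<in> {..<k}" "x \<in> {..<n}" for a x
        using v that rows[of a] vars_Ds[of a x] by (simp_all add: delta nthd_eq)
    qed
    then have "commutative_series k (sem P (\<lambda>i. Fs ! i) (\<lambda>a i. Ds ! a ! i) (Var x1)) \<longleftrightarrow>
        commutative_series k (sem P (in_out I) (in_delta I) (Var x1))"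
      unfolding commutative_series_def by auto
    moreover have cert: "commutative_series k (sem P (in_out I) (in_delta I) (Var x1)) \<longleftrightarrow> comm_cert P I"
      unfolding comm_cert_def
      using commutative_iff_cert[OF assms closed, of x1 k "in_out I"] v
      by (simp add: \<open>in_letters I = k\<close> \<open>in_states I = n\<close> \<open>in_start I = x1\<close>)
    ultimately have comm:
      "commutative_series k (sem P (\<lambda>i. Fs ! i) (\<lambda>a i. Ds ! a ! i) (Var x1)) \<longleftrightarrow> comm_cert P I"
      by simp
    have "comm_cert P I \<longleftrightarrow> \<not> noncomm_witness P I"
      using cert by (simp add: noncomm_witness_iff \<open>in_letters I = k\<close> \<open>in_start I = x1\<close>)
    from prog[OF this[unfolded I_def]] show ?thesis using comm by (simp add: I_def)
  qed
  then show ?thesis by blast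
qed

end
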